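(* Suppose each $f_i$ has $L$-Lipschitz continuous gradient and $f=\frac1n\sum_{i=1}^n f_i$ is $\mu$-strongly convex, and let $\kappa=L/\mu$. Let $0<p<1$ and $n_c\ge1$, and let $\beta_1,\beta_3<1$. With $\eta_i=p\beta_i^{n_c}+(1-p)$ for $i=1,2,3,4$, suppose the step size $\alpha>0$ satisfies $$\alpha<\min\left\{\frac1L,\ \frac{1-\eta_3}{L\eta_4},\ \frac{\eta_4(1-\eta_1)+2\eta_2p\beta_4^{n_c}}{2\eta_2\eta_4\kappa(L+\mu)}\left[\sqrt{1+\frac{4(1-\eta_1)(1-\eta_3)\eta_2\eta_4(\kappa+1)}{\left(\eta_4(1-\eta_1)+2\eta_2p\beta_4^{n_c}\right)^2}}-1\right]\right\}.$$ Then $\rho(A(n_c,p))<1$, and for every $\delta>0$ there exists a constant $C_\delta>0$ such that, for all $k\ge0$, the expected error vectors $r_k$ of the RGTA algorithm satisfy $$\|r_k\|_2\le C_\delta\left(\rho(A(n_c,p))+\delta\right)^k\|r_0\|_2.$$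
   Context: Setting: an undirected connected network with nodes $\{1,\dots,n\}$ and edge set $\mathcal E$; $f_i:\mathbb R^d\to\mathbb R$ is the local objective of node $i$ and $f=\frac1n\sum_i f_i$. Assumption on the objective: for all $z,z'\in\mathbb R^d$, $f(z')\ge f(z)+\langle\nabla f(z),z'-z\rangle+\frac\mu2\|z'-z\|_2^2$ and $\|\nabla f_i(z)-\nabla f_i(z')\|_2\le L\|z-z'\|_2$ for all $i$ (with $\mu>0$); $x^*$ is the unique minimizer of $f$. A communication matrix is a symmetric doubly stochastic $V\in\mathbb R^{n\times n}$ with $v_{ii}>0$, and for $i\ne j$: $v_{ij}\ge0$ if $(i,j)\in\mathcal E$, $v_{ij}=0$ if $(i,j)\notin\mathcal E$. Let $W_1,W_2,W_3,W_4$ be communication matrices, $Z_i=W_i\otimes I_d$, so $Z_i^{n_c}=W_i^{n_c}\otimes I_d$. Let $1_n$ be the all-ones vector and $\beta_i=\|W_i-\frac{1_n1_n^T}{n}\|_2\in[0,1]$ (so $\|W_i^{n_c}-\frac{1_n1_n^T}{n}\|_2=\beta_i^{n_c}$). $\rho(\cdot)$ denotes the spectral radius. RGTA algorithm: inputs $\mathbf x_0\in\mathbb R^{nd}$, $\alpha>0$, integer $n_c\ge1$, $p\in(0,1]$. For $\mathbf x=(x_1,\dots,x_n)\in\mathbb R^{nd}$ write $\nabla\mathbf f(\mathbf x)=(\nabla f_1(x_1),\dots,\nabla f_n(x_n))\in\mathbb R^{nd}$. Set $\mathbf y_0=\nabla\mathbf f(\mathbf x_0)$. For $k=0,1,2,\dots$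 draw independently $\theta_k\sim\mathrm{Bernoulli}(p)$; if $\theta_k=1$, $\mathbf x_{k+1}=Z_1^{n_c}\mathbf x_k-\alpha Z_2^{n_c}\mathbf y_k$ and $\mathbf y_{k+1}=Z_3^{n_c}\mathbf y_k+Z_4^{n_c}(\nabla\mathbf f(\mathbf x_{k+1})-\nabla\mathbf f(\mathbf x_k))$; if $\theta_k=0$, $\mathbf x_{k+1}=\mathbf x_k-\alpha\mathbf y_k$ and $\mathbf y_{k+1}=\mathbf y_k+\nabla\mathbf f(\mathbf x_{k+1})-\nabla\mathbf f(\mathbf x_k)$. Write $\mathbf x_k=(x_{1,k},\dots,x_{n,k})$, $\mathbf y_k=(y_{1,k},\dots,y_{n,k})$, $\bar x_k=\frac1n\sum_i x_{i,k}$, $\bar y_k=\frac1n\sum_i y_{i,k}$, and let $\bar{\mathbf x}_k,\bar{\mathbf y}_k\in\mathbb R^{nd}$ be the concatenations of $n$ copies of $\bar x_k,\bar y_k$. The expected error vector is $$r_k=\left(\mathbb E\|\bar x_k-x^*\|_2,\ \mathbb E\|\mathbf x_k-\bar{\mathbf x}_k\|_2,\ \mathbb E\|\mathbf y_k-\bar{\mathbf y}_k\|_2\right)^T\in\mathbb R^3.$$ The matrix $A(n_c,p)$ is $$A(n_c,p)=\begin{bmatrix}1-\alpha\mu&\frac{\alpha L}{\sqrt n}&0\\0&\eta_1&\alpha\eta_2\\ \sqrt n\,\eta_4\alpha L^2& p\beta_4^{n_c}L\|Z_1^{n_c}-I_{nd}\|_2+\eta_4\alpha L^2&\eta_3+\eta_4\alpha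 L\end{bmatrix}.$$ *)

theory Defs
  imports
    "HOL-Probability.Probability"
    "Jordan_Normal_Form.Spectral_Radius"
begin

(* Both HOL-Analysis and Jordan_Normal_Form use "$" and the name "mat". Here "$" is the component of a
   HOL-Analysis vector and "mat 1" the HOL-Analysis identity matrix. *)
no_notation Matrix.vec_index (infixl \<open>$\<close> 100)
hide_const (open) Matrix.mat

definition grad :: "('a::real_inner \<Rightarrow> real) \<Rightarrow> 'a \<Rightarrow> 'a" where
  "grad F z = (THE D. GDERIV F z :> D)"

definition global_obj :: "('n::finite \<Rightarrow> 'a \<Rightarrow> real) \<Rightarrow> 'a \<Rightarrow> real" where
  "global_obj f z = (1 / real CARD('n)) * (\<Sum>i\<in>UNIV. f i z)"

definition minimizer :: "('a \<Rightarrow> real) \<Rightarrow> 'a" where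
  "minimizer F = (ARG_MIN F z. True)"

(* The library's "^" on real^'n^'n is the entrywise power. *)
primrec matrix_power :: "real^'n^'n \<Rightarrow> nat \<Rightarrow> real^'n^'n" where
  "matrix_power V 0 = mat 1"
| "matrix_power V (Suc m) = V ** matrix_power V m"

definition spectral_norm :: "real^'n^'m \<Rightarrow> real" where
  "spectral_norm V = onorm (\<lambda>v. V *v v)"

definition kronecker :: "real^'n::finite^'n \<Rightarrow> real^'d::finite^'d \<Rightarrow> real^('n \<times> 'd)^('n \<times> 'd)" where
  "kronecker V U = (\<chi> q r. V $ fst q $ fst r * U $ snd q $ snd r)"

definition doubly_stochastic :: "real^'n^'n \<Rightarrow> bool" where
  "doubly_stochastic V \<longleftrightarrow>
     (\<forall>i j. 0 \<le> V $ i $ j) \<and> (\<forall>i. (\<Sum>j\<in>UNIV. V $ i $ j) = 1) \<and> (\<forall>j. (\<Sum>i\<in>UNIV. V $ i $ j) = 1)"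

definition communication_matrix :: "('n \<times> 'n) set \<Rightarrow> real^'n^'n \<Rightarrow> bool" where
  "communication_matrix E V \<longleftrightarrow>
     Finite_Cartesian_Product.transpose V = V \<and> doubly_stochastic V \<and>
     (\<forall>i. 0 < V $ i $ i) \<and>
     (\<forall>i j. i \<noteq> j \<longrightarrow> (if (i, j) \<in> E then 0 \<le> V $ i $ j else V $ i $ j = 0))"

definition mixing_factor :: "real^'n^'n \<Rightarrow> real" where
  "mixing_factor V = spectral_norm (V - (\<chi> i j. 1 / real CARD('n)))"

(* The spectral radius of a real matrix takes all its complex eigenvalues into account. *)
definition real_spectral_radius :: "real mat \<Rightarrow> real" where
  "real_spectral_radius A = spectral_radius (map_mat complex_of_real A)"

(* A stacked vector (x_1, ..., x_n) with blocks x_i in R^d is an element of real^('n * 'd), whose norm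
   is the Euclidean norm on R^(nd). *)

definition block :: "real^('n::finite \<times> 'd::finite) \<Rightarrow> 'n \<Rightarrow> real^'d" where
  "block x i = (\<chi> a. x $ (i, a))"

definition stack :: "('n::finite \<Rightarrow> real^'d::finite) \<Rightarrow> real^('n \<times> 'd)" where
  "stack v = (\<chi> q. v (fst q) $ snd q)"

definition block_mean :: "real^('n::finite \<times> 'd::finite) \<Rightarrow> real^'d" where
  "block_mean x = (1 / real CARD('n)) *\<^sub>R (\<Sum>i\<in>UNIV. block x i)"

definition stacked_mean :: "real^('n::finite \<times> 'd::finite) \<Rightarrow> real^('n \<times> 'd)" where
  "stacked_mean x = stack (\<lambda>i. block_mean x)"

definition stacked_grad :: "('n::finite \<Rightarrow> real^'d::finite \<Rightarrow> real) \<Rightarrow> real^('n \<times> 'd) \<Rightarrow> real^('n \<times> 'd)" where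
  "stacked_grad f x = stack (\<lambda>i. grad (f i) (block x i))"

definition Z_power :: "real^'n::finite^'n \<Rightarrow> nat \<Rightarrow> real^('n \<times> 'd::finite)^('n \<times> 'd)" where
  "Z_power V m = matrix_power (kronecker V (mat 1)) m"

(* The Boolean says whether the nodes communicate in this iteration. *)
definition rgta_step ::
  "('n::finite \<Rightarrow> real^'d::finite \<Rightarrow> real)
   \<Rightarrow> real^'n^'n \<Rightarrow> real^'n^'n \<Rightarrow> real^'n^'n \<Rightarrow> real^'n^'n \<Rightarrow> nat \<Rightarrow> real \<Rightarrow> bool
   \<Rightarrow> (real^('n \<times> 'd)) \<times> (real^('n \<times> 'd)) \<Rightarrow> (real^('n \<times> 'd)) \<times> (real^('n \<times> 'd))" where
  "rgta_step f W1 W2 W3 W4 nc \<alpha> b xy = (case xy of (x, y) \<Rightarrow>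
     if b then
       (let x' = Z_power W1 nc *v x - \<alpha> *\<^sub>R (Z_power W2 nc *v y)
        in (x', Z_power W3 nc *v y + Z_power W4 nc *v (stacked_grad f x' - stacked_grad f x)))
     else
       (let x' = x - \<alpha> *\<^sub>R y
        in (x', y + stacked_grad f x' - stacked_grad f x)))"

primrec rgta ::
  "('n::finite \<Rightarrow> real^'d::finite \<Rightarrow> real)
   \<Rightarrow> real^'n^'n \<Rightarrow> real^'n^'n \<Rightarrow> real^'n^'n \<Rightarrow> real^'n^'n \<Rightarrow> nat \<Rightarrow> real
   \<Rightarrow> real^('n \<times> 'd) \<Rightarrow> (nat \<Rightarrow> bool) \<Rightarrow> nat \<Rightarrow> (real^('n \<times> 'd)) \<times> (real^('n \<times> 'd))" where
  "rgta f W1 W2 W3 W4 nc \<alpha> x0 t 0 = (x0, stacked_grad f x0)"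
| "rgta f W1 W2 W3 W4 nc \<alpha> x0 t (Suc k) =
     rgta_step f W1 W2 W3 W4 nc \<alpha> (t k) (rgta f W1 W2 W3 W4 nc \<alpha> x0 t k)"

definition rgta_error ::
  "'w measure \<Rightarrow> (nat \<Rightarrow> 'w \<Rightarrow> bool) \<Rightarrow> ('n::finite \<Rightarrow> real^'d::finite \<Rightarrow> real)
   \<Rightarrow> real^'n^'n \<Rightarrow> real^'n^'n \<Rightarrow> real^'n^'n \<Rightarrow> real^'n^'n \<Rightarrow> nat \<Rightarrow> real
   \<Rightarrow> real^('n \<times> 'd) \<Rightarrow> nat \<Rightarrow> real^3" where
  "rgta_error M \<theta> f W1 W2 W3 W4 nc \<alpha> x0 k =
     (let x = (\<lambda>\<omega>. fst (rgta f W1 W2 W3 W4 nc \<alpha> x0 (\<lambda>j. \<theta> j \<omega>) k));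
          y = (\<lambda>\<omega>. snd (rgta f W1 W2 W3 W4 nc \<alpha> x0 (\<lambda>j. \<theta> j \<omega>) k))
      in vector
           [\<integral>\<omega>. norm (block_mean (x \<omega>) - minimizer (global_obj f)) \<partial>M,
            \<integral>\<omega>. norm (x \<omega> - stacked_mean (x \<omega>)) \<partial>M,
            \<integral>\<omega>. norm (y \<omega> - stacked_mean (y \<omega>)) \<partial>M])"

definition bernoulli_iid :: "'w measure \<Rightarrow> real \<Rightarrow> (nat \<Rightarrow> 'w \<Rightarrow> bool) \<Rightarrow> bool" where
  "bernoulli_iid M p \<theta> \<longleftrightarrow>
     prob_space.indep_vars M (\<lambda>_. count_space UNIV) \<theta> UNIV \<and>
     (\<forall>k. distr M (count_space UNIV) (\<theta> k) = measure_pmf (bernoulli_pmf p))"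

definition eta :: "real \<Rightarrow> nat \<Rightarrow> real^'n^'n \<Rightarrow> real" where
  "eta p nc V = p * mixing_factor V ^ nc + (1 - p)"

(* The type argument fixes the dimension d in kronecker W1 I_d. *)
definition rgta_matrix ::
  "'d::finite itself \<Rightarrow> real^'n::finite^'n \<Rightarrow> real^'n^'n \<Rightarrow> real^'n^'n \<Rightarrow> real^'n^'n
   \<Rightarrow> real \<Rightarrow> real \<Rightarrow> real \<Rightarrow> nat \<Rightarrow> real \<Rightarrow> real mat" where
  "rgta_matrix TYPE('d) W1 W2 W3 W4 \<alpha> \<mu> L nc p =
     (let n = real CARD('n);
          \<eta>1 = eta p nc W1; \<eta>2 = eta p nc W2; \<eta>3 = eta p nc W3; \<eta>4 = eta p nc W4;
          \<beta>4 = mixing_factor W4;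
          Z1nc = (Z_power W1 nc :: real^('n \<times> 'd)^('n \<times> 'd))
      in mat_of_rows_list 3
           [[1 - \<alpha> * \<mu>, \<alpha> * L / sqrt n, 0],
            [0, \<eta>1, \<alpha> * \<eta>2],
            [sqrt n * \<eta>4 * \<alpha> * L\<^sup>2,
             p * \<beta>4 ^ nc * L * spectral_norm (Z1nc - mat 1) + \<eta>4 * \<alpha> * L\<^sup>2,
             \<eta>3 + \<eta>4 * \<alpha> * L]])"

end

theory Submission
  imports Defs
begin

text \<open>
  Gradient tracking preserves the identity between the mean of the trackers and the mean of the local
  gradients, so the network average performs a gradient step on \<open>f\<close> perturbed by the consensus error,
  and such a step contracts by \<open>1 - \<alpha> \<mu>\<close> because \<open>\<alpha> < 1 / L\<close>. The consensus and tracking errors are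
  contracted by the mixing matrices. An iteration without communication is an iteration with
  \<open>n\<^sub>c = 0\<close>, so both cases of the coin obey one pathwise linear inequality between the three errors.
  Since \<open>\<theta>\<^sub>k\<close> is independent of the past, taking expectations averages its coefficients to
  \<open>r\<^sub>k\<^sub>+\<^sub>1 \<le> A r\<^sub>k\<close> with \<open>A \<ge> 0\<close>, hence \<open>r\<^sub>k \<le> A\<^sup>k r\<^sub>0\<close>, and the entries of \<open>A\<^sup>k\<close> are
  \<open>O((\<rho>(A) + \<delta>)\<^sup>k)\<close> by the Jordan normal form. The last bound on the step size is the positive root
  of a quadratic that minorizes \<open>det (I - A) / (\<alpha> \<mu>)\<close>; positivity of the determinant yields a vector
  \<open>v > 0\<close> with \<open>A v < v\<close>, and therefore \<open>\<rho>(A) < 1\<close>.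
\<close>

section \<open>Nonnegative matrices and the spectral radius\<close>

lemma real_spectral_radius_nonneg:
  assumes "A \<in> carrier_mat n n" "0 < n"
  shows "0 \<le> real_spectral_radius A"
proof -
  have "map_mat complex_of_real A \<in> carrier_mat n n" using assms by simp
  from spectral_radius_mem_max(1)[OF this assms(2)] show ?thesis
    unfolding real_spectral_radius_def by auto
qed

text \<open>The last hypothesis says that \<open>A\<close> contracts the maximum norm weighted by
  \<open>v\<close>. The modulus of an eigenvector \<open>u\<close> is compared with \<open>v\<close>
  at an index where their ratio \<open>t\<close> is largest; there the eigenvalue equation gives
  \<open>cmod c * (t * v m) < t * v m\<close>.\<close>

lemma real_spectral_radius_less_1:
  fixes A :: "real mat" and v :: "nat \<Rightarrow> real"
  assumes A: "A \<in> carrier_mat n n" and n: "0 < n"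
    and nonneg: "\<And>i j. i < n \<Longrightarrow> j < n \<Longrightarrow> 0 \<le> A $$ (i, j)"
    and v: "\<And>i. i < n \<Longrightarrow> 0 < v i"
    and Av: "\<And>i. i < n \<Longrightarrow> (\<Sum>j<n. A $$ (i, j) * v j) < v i"
  shows "real_spectral_radius A < 1"
proof -
  let ?B = "map_mat complex_of_real A"
  have B: "?B \<in> carrier_mat n n" using A by simp
  obtain c where c: "c \<in> spectrum ?B" "real_spectral_radius A = cmod c"
    using spectral_radius_mem_max(1)[OF B n] unfolding real_spectral_radius_def by auto
  then obtain u where u: "eigenvector ?B u c"
    unfolding spectrum_def eigenvalue_def by auto
  have uc: "u \<in> carrier_vec n" "u \<noteq> 0\<^sub>v n" and eq: "?B *\<^sub>v u = c \<cdot>\<^sub>v u"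
    using u A unfolding eigenvector_def by auto
  define t where "t = Max ((\<lambda>i. cmod (Matrix.vec_index u i) / v i) ` {..<n})"
  have le: "cmod (Matrix.vec_index u i) \<le> t * v i" if "i < n" for i
  proof -
    have "cmod (Matrix.vec_index u i) / v i \<le> t"
      unfolding t_def using that by (intro Max_ge) auto
    thus ?thesis using v[OF that] by (simp add: divide_le_eq)
  qed
  have "t \<in> (\<lambda>i. cmod (Matrix.vec_index u i) / v i) ` {..<n}"
    unfolding t_def using n by (intro Max_in) auto
  then obtain m where m: "m < n" "t * v m = cmod (Matrix.vec_index u m)"
    using v by fastforce
  obtain i0 where i0: "i0 < n" "Matrix.vec_index u i0 \<noteq> 0"
    using uc by (metis carrier_vecD eq_vecI index_zero_vec(1) index_zero_vec(2))
  have tpos: "0 < t"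
    using le[OF i0(1)] i0 v[OF i0(1)] by (smt (verit) mult_nonpos_nonneg zero_less_norm_iff)
  have "cmod c * (t * v m) = cmod (Matrix.vec_index (c \<cdot>\<^sub>v u) m)"
    using m uc by (simp add: norm_mult)
  also have "\<dots> = cmod (\<Sum>j<n. of_real (A $$ (m, j)) * Matrix.vec_index u j)"
    unfolding eq[symmetric] using A uc m
    by (auto simp: scalar_prod_def lessThan_atLeast0 intro!: arg_cong[where f = cmod] sum.cong)
  also have "\<dots> \<le> (\<Sum>j<n. A $$ (m, j) * (t * v j))"
    using le nonneg m
    by (intro order_trans[OF norm_sum] sum_mono) (auto simp: norm_mult intro!: mult_left_mono)
  also have "\<dots> = t * (\<Sum>j<n. A $$ (m, j) * v j)"
    by (simp add: sum_distrib_left algebra_simps)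
  also have "\<dots> < t * v m"
    using Av[OF m(1)] tpos by simp
  finally have "cmod c * (t * v m) < 1 * (t * v m)" by simp
  thus ?thesis using tpos v[OF m(1)] unfolding c(2) by (subst (asm) mult_less_cancel_right) simp
qed

lemma pow_mat_smult:
  fixes A :: "'a::comm_semiring_1 mat"
  assumes A: "A \<in> carrier_mat n n"
  shows "(c \<cdot>\<^sub>m A) ^\<^sub>m k = c ^ k \<cdot>\<^sub>m (A ^\<^sub>m k)"
proof (induction k)
  case 0
  show ?case using A by (intro eq_matI) auto
next
  case (Suc k)
  have Ak: "A ^\<^sub>m k \<in> carrier_mat n n" using A by simp
  have "(c \<cdot>\<^sub>m A) ^\<^sub>m Suc k = (c ^ k \<cdot>\<^sub>m (A ^\<^sub>m k)) * (c \<cdot>\<^sub>m A)" using Suc by simp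
  also have "\<dots> = c ^ k \<cdot>\<^sub>m ((A ^\<^sub>m k) * (c \<cdot>\<^sub>m A))"
    using A Ak by (subst mult_smult_assoc_mat[of _ n n _ n]) auto
  also have "(A ^\<^sub>m k) * (c \<cdot>\<^sub>m A) = c \<cdot>\<^sub>m (A ^\<^sub>m k * A)"
    using A Ak by (subst mult_smult_distrib[of _ n n _ n]) auto
  finally show ?case using A Ak by (intro eq_matI) (auto simp: algebra_simps)
qed

text \<open>Dividing \<open>A\<close> by \<gamma> = \<rho>(A) + \<delta> moves all eigenvalues
  strictly inside the unit disc, and the Jordan normal form then bounds all powers of the quotient
  by one constant.\<close>

lemma pow_mat_entries_spectral_radius_bound:
  fixes A :: "real mat"
  assumes A: "A \<in> carrier_mat n n" and n: "0 < n" and \<delta>: "0 < \<delta>"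
  obtains C where "0 < C"
    "\<And>k i j. i < n \<Longrightarrow> j < n \<Longrightarrow> \<bar>(A ^\<^sub>m k) $$ (i, j)\<bar> \<le> C * (real_spectral_radius A + \<delta>) ^ k"
proof -
  let ?B = "map_mat complex_of_real A"
  define \<gamma> where "\<gamma> = real_spectral_radius A + \<delta>"
  define D where "D = complex_of_real (1 / \<gamma>) \<cdot>\<^sub>m ?B"
  have \<gamma>: "0 < \<gamma>" "real_spectral_radius A < \<gamma>"
    using real_spectral_radius_nonneg[OF A n] \<delta> by (auto simp: \<gamma>_def)
  have B: "?B \<in> carrier_mat n n" and D: "D \<in> carrier_mat n n" using A by (auto simp: D_def)
  have "spectral_radius D < 1"
  proof -
    obtain c where c: "c \<in> spectrum D" "spectral_radius D = cmod c"
      using spectral_radius_mem_max(1)[OF D n] by auto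
    then obtain u where u: "eigenvector D u c"
      unfolding spectrum_def eigenvalue_def by auto
    have uc: "u \<in> carrier_vec n" "u \<noteq> 0\<^sub>v n" and eq: "D *\<^sub>v u = c \<cdot>\<^sub>v u"
      using u D unfolding eigenvector_def by auto
    have "?B *\<^sub>v u = complex_of_real \<gamma> \<cdot>\<^sub>v (D *\<^sub>v u)"
      using \<gamma> A uc by (intro eq_vecI) (auto simp: D_def scalar_prod_def sum_distrib_left)
    also have "\<dots> = (\<gamma> * c) \<cdot>\<^sub>v u" unfolding eq by (simp add: smult_smult_assoc)
    finally have "eigenvector ?B u (\<gamma> * c)" using uc A unfolding eigenvector_def by simp
    hence "cmod (\<gamma> * c) \<in> norm ` spectrum ?B" unfolding spectrum_def eigenvalue_def by blast
    hence "cmod (\<gamma> * c) \<le> real_spectral_radius A"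
      unfolding real_spectral_radius_def by (rule spectral_radius_mem_max(2)[OF B n])
    hence "\<gamma> * cmod c < \<gamma> * 1" using \<gamma>(2) unfolding norm_mult norm_of_real abs_of_pos[OF \<gamma>(1)] mult_1_right by linarith
    thus ?thesis using \<gamma> c by (simp only: mult_less_cancel_left_pos)
  qed
  then obtain C where C: "\<And>k. norm_bound (D ^\<^sub>m k) C"
    using spectral_radius_jnf_norm_bound_less_1_upper_triangular[OF D] by blast
  \<comment> \<open>The maximum with 1 only serves to make the constant positive.\<close>
  have "\<bar>(A ^\<^sub>m k) $$ (i, j)\<bar> \<le> max C 1 * \<gamma> ^ k" if ij: "i < n" "j < n" for k i j
  proof -
    have "D ^\<^sub>m k = complex_of_real (1 / \<gamma>) ^ k \<cdot>\<^sub>m map_mat complex_of_real (A ^\<^sub>m k)"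
      unfolding D_def pow_mat_smult[OF B] of_real_hom.mat_hom_pow[OF A] ..
    hence "(D ^\<^sub>m k) $$ (i, j) = complex_of_real ((1 / \<gamma>) ^ k * (A ^\<^sub>m k) $$ (i, j))"
      using ij A by simp
    moreover have "cmod ((D ^\<^sub>m k) $$ (i, j)) \<le> C"
      using C[of k] ij D unfolding norm_bound_def by simp
    ultimately have "(1 / \<gamma>) ^ k * \<bar>(A ^\<^sub>m k) $$ (i, j)\<bar> \<le> C"
      using \<gamma> by (simp only: norm_of_real abs_mult power_abs abs_divide abs_one abs_of_pos)
    hence "\<bar>(A ^\<^sub>m k) $$ (i, j)\<bar> \<le> C * \<gamma> ^ k"
      using \<gamma> by (simp add: field_simps)
    also have "\<dots> \<le> max C 1 * \<gamma> ^ k" using \<gamma> by (intro mult_right_mono) auto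
    finally show ?thesis .
  qed
  thus ?thesis using that[of "max C 1"] unfolding \<gamma>_def by auto
qed

text \<open>Powers of a nonnegative matrix are monotone on vectors. The induction generalizes over
  \<open>r\<close> and is applied to the shifted sequence, which fits the unfolding of the power
  with the new factor on the right.\<close>

lemma nonneg_recursion_pow_mat_bound:
  fixes A :: "real mat" and r :: "nat \<Rightarrow> nat \<Rightarrow> real"
  assumes A: "A \<in> carrier_mat n n"
    and nonneg: "\<And>i j. i < n \<Longrightarrow> j < n \<Longrightarrow> 0 \<le> A $$ (i, j)"
    and step: "\<And>k i. i < n \<Longrightarrow> r (Suc k) i \<le> (\<Sum>j<n. A $$ (i, j) * r k j)"
    and i: "i < n"
  shows "r k i \<le> (\<Sum>j<n. (A ^\<^sub>m k) $$ (i, j) * r 0 j)"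
proof -
  have Suc_entry: "(A ^\<^sub>m Suc k) $$ (i, l) = (\<Sum>j<n. (A ^\<^sub>m k) $$ (i, j) * A $$ (j, l))"
    if "i < n" "l < n" for k i l
    using A that by (simp add: scalar_prod_def lessThan_atLeast0)
  have pow_nonneg: "0 \<le> (A ^\<^sub>m k) $$ (i, j)" if "i < n" "j < n" for k i j
    using that
  proof (induction k arbitrary: j)
    case (Suc k)
    show ?case unfolding Suc_entry[OF Suc.prems]
      using Suc nonneg by (intro sum_nonneg mult_nonneg_nonneg) auto
  qed (use A in auto)
  show ?thesis using i step
  proof (induction k arbitrary: r)
    case 0
    have "(\<Sum>j<n. (A ^\<^sub>m 0) $$ (i, j) * r 0 j) = (\<Sum>j<n. if i = j then r 0 j else 0)"
      using A 0 by (intro sum.cong) auto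
    thus ?case using 0 by simp
  next
    case (Suc k)
    have "r (Suc k) i \<le> (\<Sum>j<n. (A ^\<^sub>m k) $$ (i, j) * r (Suc 0) j)"
      using Suc.IH[of "\<lambda>k. r (Suc k)"] Suc.prems by simp
    also have "\<dots> \<le> (\<Sum>j<n. (A ^\<^sub>m k) $$ (i, j) * (\<Sum>l<n. A $$ (j, l) * r 0 l))"
      using pow_nonneg Suc.prems by (intro sum_mono mult_left_mono) auto
    also have "\<dots> = (\<Sum>l<n. (\<Sum>j<n. (A ^\<^sub>m k) $$ (i, j) * A $$ (j, l)) * r 0 l)"
      unfolding sum_distrib_left sum_distrib_right by (subst sum.swap) (simp add: mult.assoc)
    also have "\<dots> = (\<Sum>l<n. (A ^\<^sub>m Suc k) $$ (i, l) * r 0 l)"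
      using Suc.prems(1) by (intro sum.cong) (simp_all only: Suc_entry lessThan_iff)
    finally show ?case .
  qed
qed

section \<open>The step-size condition as positivity of det (I - A)\<close>

text \<open>Here \<open>b\<close> stands for \<open>p * \<beta>4 ^ nc\<close>. As a quadratic in L
  \<alpha> with coefficients \<open>e\<close>, \<open>B\<close> and \<open>-D\<close>, the
  conclusion holds below the positive root, and that root divided by L is the assumed bound;
  isolating the square root and squaring undoes the quadratic formula.\<close>

lemma step_size_determinant_pos:
  fixes \<eta>1 \<eta>2 \<eta>3 \<eta>4 b L \<mu> \<kappa> \<alpha> :: real
  assumes pos: "0 < L" "0 < \<mu>" "0 < \<alpha>" "0 < \<eta>2" "0 < \<eta>4" "\<eta>1 < 1" "\<eta>3 < 1" "0 \<le> b"
    and \<kappa>: "\<kappa> = L / \<mu>"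
    and \<alpha>: "\<alpha> < (\<eta>4 * (1 - \<eta>1) + 2 * \<eta>2 * b) / (2 * \<eta>2 * \<eta>4 * \<kappa> * (L + \<mu>)) *
         (sqrt (1 + 4 * (1 - \<eta>1) * (1 - \<eta>3) * \<eta>2 * \<eta>4 * (\<kappa> + 1) /
                    (\<eta>4 * (1 - \<eta>1) + 2 * \<eta>2 * b)\<^sup>2) - 1)"
  shows "\<alpha> * L * (\<eta>4 * (1 - \<eta>1) + 2 * \<eta>2 * b) + \<alpha>\<^sup>2 * L\<^sup>2 * \<eta>2 * \<eta>4 * (\<kappa> + 1)
    < (1 - \<eta>1) * (1 - \<eta>3)"
proof -
  define B where "B = \<eta>4 * (1 - \<eta>1) + 2 * \<eta>2 * b"
  define e where "e = \<eta>2 * \<eta>4 * (\<kappa> + 1)"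
  define D where "D = (1 - \<eta>1) * (1 - \<eta>3)"
  have B: "0 < B" using pos by (auto simp: B_def intro!: add_pos_nonneg)
  have e: "0 < e" using pos by (auto simp: e_def \<kappa> intro!: mult_pos_pos add_pos_pos)
  have D: "0 < D" using pos by (simp add: D_def)
  \<comment> \<open>Since \<kappa> \<mu> = L, the denominator of the bound is twice the leading
    coefficient \<open>e\<close> times L.\<close>
  have "\<kappa> * (L + \<mu>) = (\<kappa> + 1) * L" using pos by (simp add: \<kappa> field_simps)
  hence c: "2 * \<eta>2 * \<eta>4 * \<kappa> * (L + \<mu>) = 2 * (e * L)" by (simp add: e_def mult.assoc)
  have d: "4 * (1 - \<eta>1) * (1 - \<eta>3) * \<eta>2 * \<eta>4 * (\<kappa> + 1) = 4 * D * e"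
    by (simp only: D_def e_def mult.assoc)
  have "\<alpha> < B / (2 * (e * L)) * (sqrt (1 + 4 * D * e / B\<^sup>2) - 1)"
    using \<alpha> unfolding B_def[symmetric] c d .
  hence "1 + 2 * e * L * \<alpha> / B < sqrt (1 + 4 * D * e / B\<^sup>2)"
    using B e pos by (simp add: field_simps)
  hence "(1 + 2 * e * L * \<alpha> / B)\<^sup>2 < (sqrt (1 + 4 * D * e / B\<^sup>2))\<^sup>2"
    using B e pos by (intro power_strict_mono) auto
  also have "\<dots> = 1 + 4 * D * e / B\<^sup>2" using B e D by (intro real_sqrt_pow2) simp
  finally have "(4 * e * (L * \<alpha> * B + e * L\<^sup>2 * \<alpha>\<^sup>2)) / B\<^sup>2 < (4 * e * D) / B\<^sup>2"
    using B by (simp add: power2_eq_square field_simps)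
  hence "L * \<alpha> * B + e * L\<^sup>2 * \<alpha>\<^sup>2 < D" using B e by (simp add: divide_less_cancel)
  thus ?thesis by (simp add: B_def e_def D_def mult_ac)
qed

text \<open>Equality in the first two rows of \<open>A v \<le> v\<close> forces, up to scaling,
  \<open>v = (L / (\<surd>n \<mu>), 1, (1 - \<eta>1) / (\<alpha> \<eta>2))\<close>; the third row is then strict because
  \<open>det (I - A) > 0\<close>, and the slack allows to perturb \<open>v\<close> so that all rows become strict.\<close>

lemma rgta_matrix_subinvariant_vector:
  fixes \<eta>1 \<eta>2 \<eta>3 \<eta>4 w L \<mu> \<kappa> \<alpha> s :: real
  assumes pos: "0 < L" "0 < \<mu>" "0 < \<alpha>" "0 < s" "0 < \<eta>2" "0 < \<eta>4" "\<eta>1 < 1"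
    and diag: "\<eta>3 + \<eta>4 * \<alpha> * L < 1"
    and \<kappa>: "\<kappa> = L / \<mu>"
    and det: "\<alpha> * L * \<eta>4 * (1 - \<eta>1) + \<alpha> * \<eta>2 * w + \<alpha>\<^sup>2 * L\<^sup>2 * \<eta>2 * \<eta>4 * (\<kappa> + 1)
      < (1 - \<eta>1) * (1 - \<eta>3)"
  obtains v0 v2 where "0 < v0" "0 < v2"
    "(1 - \<alpha> * \<mu>) * v0 + \<alpha> * L / s < v0"
    "\<eta>1 + \<alpha> * \<eta>2 * v2 < 1"
    "s * \<eta>4 * \<alpha> * L\<^sup>2 * v0 + (w + \<eta>4 * \<alpha> * L\<^sup>2) + (\<eta>3 + \<eta>4 * \<alpha> * L) * v2 < v2"
proof -
  \<comment> \<open>\<open>u\<close> is the third component that gives equality in the second row.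
    \<open>\<sigma>\<close> is the slack of the third row at the unperturbed vector, and
    \<open>K\<close> is the rate at which it shrinks when the first component is raised and the
    third lowered by the same amount.\<close>
  define u where "u = (1 - \<eta>1) / (\<alpha> * \<eta>2)"
  define K where "K = s * \<eta>4 * \<alpha> * L\<^sup>2 + (1 - \<eta>3 - \<eta>4 * \<alpha> * L)"
  define \<sigma> where "\<sigma> = (1 - \<eta>3 - \<eta>4 * \<alpha> * L) * u - (\<eta>4 * \<alpha> * L\<^sup>2 * \<kappa> + w + \<eta>4 * \<alpha> * L\<^sup>2)"
  define \<epsilon> where "\<epsilon> = min (u / 2) (\<sigma> / (2 * K))"
  have u: "0 < u" "\<alpha> * \<eta>2 * u = 1 - \<eta>1" using pos by (auto simp: u_def)
  have K: "0 < K" using pos diag by (auto simp: K_def intro!: add_pos_pos)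
  \<comment> \<open>The right-hand side is det (I - A) / (\<alpha> \<mu>), which \<open>det\<close>
    makes positive.\<close>
  have "\<alpha> * \<eta>2 * \<sigma> = (1 - \<eta>3 - \<eta>4 * \<alpha> * L) * (\<alpha> * \<eta>2 * u)
      - \<alpha> * \<eta>2 * (\<eta>4 * \<alpha> * L\<^sup>2 * \<kappa> + w + \<eta>4 * \<alpha> * L\<^sup>2)"
    by (simp add: \<sigma>_def algebra_simps)
  also have "\<dots> > 0" unfolding u using det by (simp add: algebra_simps power2_eq_square)
  finally have \<sigma>: "0 < \<sigma>" by (rule zero_less_mult_pos) (use pos in simp)
  have \<epsilon>: "0 < \<epsilon>" "\<epsilon> < u" "\<epsilon> * K < \<sigma>"
  proof -
    have "\<epsilon> \<le> \<sigma> / (2 * K)" by (simp add: \<epsilon>_def)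
    hence "\<epsilon> * K \<le> \<sigma> / 2" using K by (simp add: field_simps)
    thus "\<epsilon> * K < \<sigma>" using \<sigma> by simp
    show "0 < \<epsilon>" "\<epsilon> < u" using u \<sigma> K by (auto simp: \<epsilon>_def)
  qed
  define a where "a = L / (s * \<mu>)"
  have a: "0 < a" "\<alpha> * \<mu> * a = \<alpha> * L / s" "s * a = \<kappa>" using pos by (auto simp: a_def \<kappa>)
  show thesis
  proof
    show "0 < a + \<epsilon>" "0 < u - \<epsilon>" using a \<epsilon> by auto
    have "0 < \<alpha> * \<mu> * \<epsilon>" using pos \<epsilon> by simp
    thus "(1 - \<alpha> * \<mu>) * (a + \<epsilon>) + \<alpha> * L / s < a + \<epsilon>"
      using a(2) by (simp add: algebra_simps)
    have "0 < \<alpha> * \<eta>2 * \<epsilon>" using pos \<epsilon> by simp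
    thus "\<eta>1 + \<alpha> * \<eta>2 * (u - \<epsilon>) < 1" using u(2) by (simp add: algebra_simps)
    have eq: "s * \<eta>4 * \<alpha> * L\<^sup>2 * (a + \<epsilon>) = \<eta>4 * \<alpha> * L\<^sup>2 * \<kappa> + \<epsilon> * (s * \<eta>4 * \<alpha> * L\<^sup>2)"
      unfolding a(3)[symmetric] by (simp add: algebra_simps)
    show "s * \<eta>4 * \<alpha> * L\<^sup>2 * (a + \<epsilon>) + (w + \<eta>4 * \<alpha> * L\<^sup>2) + (\<eta>3 + \<eta>4 * \<alpha> * L) * (u - \<epsilon>) < u - \<epsilon>"
      using \<epsilon>(3) unfolding eq K_def \<sigma>_def by (simp add: algebra_simps)
  qed
qed

section \<open>Gradient steps for smooth strongly convex functions\<close>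

lemma GDERIV_unique:
  assumes "GDERIV F z :> D" "GDERIV F z :> D'"
  shows "D = D'"
proof -
  have "(\<lambda>h. inner h D) = (\<lambda>h. inner h D')"
    using assms unfolding gderiv_def by (rule has_derivative_unique)
  hence "inner (D - D') D = inner (D - D') D'" by metis
  hence "inner (D - D') (D - D') = 0" by (simp add: inner_diff_right)
  thus ?thesis by simp
qed

lemma grad_eqI: "GDERIV F z :> D \<Longrightarrow> grad F z = D"
  unfolding grad_def by (rule the_equality) (auto intro: GDERIV_unique)

text \<open>The definite description in \<open>grad\<close> has a value: the Riesz representative of
  the derivative is assembled from its values on the basis.\<close>

lemma GDERIV_grad:
  fixes F :: "'a::euclidean_space \<Rightarrow> real"
  assumes "F differentiable (at z)"
  shows "GDERIV F z :> grad F z"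
proof -
  obtain F' where F': "(F has_derivative F') (at z)"
    using assms unfolding differentiable_def by auto
  then interpret bounded_linear F' by (rule has_derivative_bounded_linear)
  have "F' h = inner h (\<Sum>b\<in>Basis. F' b *\<^sub>R b)" for h
  proof -
    have "F' h = F' (\<Sum>b\<in>Basis. inner h b *\<^sub>R b)" by (simp add: euclidean_representation)
    also have "\<dots> = inner h (\<Sum>b\<in>Basis. F' b *\<^sub>R b)"
      by (simp add: sum scale inner_sum_right mult.commute)
    finally show ?thesis .
  qed
  hence "GDERIV F z :> (\<Sum>b\<in>Basis. F' b *\<^sub>R b)"
    using F' unfolding gderiv_def by (metis (no_types, lifting) ext)
  thus ?thesis using grad_eqI by metis
qed

lemma GDERIV_has_real_derivative_along_line:
  assumes "GDERIV F (z + t *\<^sub>R d) :> D"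
  shows "((\<lambda>t. F (z + t *\<^sub>R d)) has_real_derivative inner D d) (at t)"
proof -
  have *: "((\<lambda>t. z + t *\<^sub>R d) has_derivative (\<lambda>h. h *\<^sub>R d)) (at t)"
    by (auto intro!: derivative_eq_intros)
  have "((\<lambda>t. F (z + t *\<^sub>R d)) has_derivative (\<lambda>h. inner (h *\<^sub>R d) D)) (at t)"
    using has_derivative_compose[OF *] assms unfolding gderiv_def by blast
  moreover have "(\<lambda>h. inner (h *\<^sub>R d) D) = (*) (inner D d)"
    by (simp add: fun_eq_iff inner_commute)
  ultimately show ?thesis by (simp add: has_field_derivative_def)
qed

text \<open>The descent lemma. Along the segment, \<open>\<phi>\<close> is F minus the linear and
  quadratic terms of the bound; Cauchy-Schwarz and the Lipschitz condition make its derivative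
  nonpositive.\<close>

lemma lipschitz_gradient_upper_bound:
  fixes F :: "'a::real_inner \<Rightarrow> real"
  assumes F: "\<And>z. GDERIV F z :> G z"
    and lip: "\<And>z z'. norm (G z - G z') \<le> L * norm (z - z')"
  shows "F z' \<le> F z + inner (G z) (z' - z) + L / 2 * (norm (z' - z))\<^sup>2"
proof -
  define d where "d = z' - z"
  define \<phi> where "\<phi> t = F (z + t *\<^sub>R d) - t * inner (G z) d - L / 2 * t\<^sup>2 * (norm d)\<^sup>2" for t
  have "\<exists>D. (\<phi> has_real_derivative D) (at t) \<and> D \<le> 0" if "0 \<le> t" for t
  proof -
    have "(\<phi> has_real_derivative
        inner (G (z + t *\<^sub>R d)) d - inner (G z) d - L * t * (norm d)\<^sup>2) (at t)"
      unfolding \<phi>_def using GDERIV_has_real_derivative_along_line[OF F]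
      by (auto intro!: derivative_eq_intros)
    moreover have "inner (G (z + t *\<^sub>R d)) d - inner (G z) d \<le> L * t * (norm d)\<^sup>2"
    proof -
      have "inner (G (z + t *\<^sub>R d) - G z) d \<le> norm (G (z + t *\<^sub>R d) - G z) * norm d"
        by (rule norm_cauchy_schwarz)
      also have "\<dots> \<le> (L * norm (t *\<^sub>R d)) * norm d"
        using lip[of "z + t *\<^sub>R d" z] by (intro mult_right_mono) auto
      finally show ?thesis using that by (simp add: inner_diff_left power2_eq_square mult.assoc)
    qed
    ultimately show ?thesis by force
  qed
  hence "\<phi> 1 \<le> \<phi> 0" by (intro DERIV_nonpos_imp_nonincreasing[of 0 1 \<phi>]) simp_all
  thus ?thesis by (simp add: \<phi>_def d_def)
qed

text \<open>The Baillon-Haddad argument for \<open>F - \<mu>/2 |.|\<^sup>2\<close>, which is convex and \<open>(L - \<mu>)\<close>-smooth.\<close>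

lemma strongly_convex_smooth_cocoercive:
  fixes F :: "'a::real_inner \<Rightarrow> real"
  assumes upper: "\<And>z z'. F z' \<le> F z + inner (G z) (z' - z) + L / 2 * (norm (z' - z))\<^sup>2"
    and lower: "\<And>z z'. F z' \<ge> F z + inner (G z) (z' - z) + \<mu> / 2 * (norm (z' - z))\<^sup>2"
    and "\<mu> \<le> L"
  defines "H \<equiv> \<lambda>z. G z - \<mu> *\<^sub>R z"
  shows "(norm (H x - H y))\<^sup>2 \<le> (L - \<mu>) * inner (H x - H y) (x - y)"
proof -
  define h where "h z = F z - \<mu> / 2 * inner z z" for z
  have sq: "(norm (b - a))\<^sup>2 = inner b b - inner a a - 2 * inner a (b - a)" for a b :: 'a
    by (simp add: power2_norm_eq_inner inner_diff_left inner_diff_right inner_commute)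
  have convex: "h a + inner (H a) (b - a) \<le> h b" for a b
    using lower[of a b] unfolding h_def H_def sq
    by (simp add: inner_diff_left algebra_simps)
  have smooth: "h b \<le> h a + inner (H a) (b - a) + (L - \<mu>) / 2 * (norm (b - a))\<^sup>2" for a b
    using upper[where z' = b and z = a] unfolding h_def H_def sq
    by (simp add: inner_diff_left algebra_simps diff_divide_distrib add_divide_distrib)
  \<comment> \<open>The point y + t (H x - H y) is bounded below by convexity from x and above by
    smoothness from y.\<close>
  have half: "t * (norm (H x - H y))\<^sup>2 - (L - \<mu>) / 2 * t\<^sup>2 * (norm (H x - H y))\<^sup>2
      \<le> h y - h x - inner (H x) (y - x)" for t x y
  proof -
    define g where "g = H x - H y"
    have "h x + inner (H x) (y + t *\<^sub>R g - x) \<le> h (y + t *\<^sub>R g)" by (rule convex)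
    also have "\<dots> \<le> h y + inner (H y) (t *\<^sub>R g) + (L - \<mu>) / 2 * (norm (t *\<^sub>R g))\<^sup>2"
      using smooth[of "y + t *\<^sub>R g" y] by simp
    finally have "t * inner g g - (L - \<mu>) / 2 * t\<^sup>2 * (norm g)\<^sup>2 \<le> h y - h x - inner (H x) (y - x)"
      unfolding g_def norm_scaleR power_mult_distrib power2_abs
      by (simp add: inner_diff_right inner_diff_left inner_add_right inner_commute algebra_simps)
    thus ?thesis by (simp add: g_def power2_norm_eq_inner)
  qed
  define N where "N = (norm (H x - H y))\<^sup>2"
  define I where "I = inner (H x - H y) (x - y)"
  \<comment> \<open>Adding \<open>half\<close> for both orders of x and y cancels the values of
    \<open>h\<close>.\<close>
  have *: "2 * t * N - (L - \<mu>) * t\<^sup>2 * N \<le> I" for t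
  proof -
    have "I = - inner (H x) (y - x) - inner (H y) (x - y)"
      by (simp add: I_def inner_diff_left inner_diff_right)
    moreover have "(norm (H y - H x))\<^sup>2 = N" by (simp add: N_def norm_minus_commute)
    ultimately show ?thesis
      using half[of t x y] half[of t y x] by (simp add: N_def[symmetric])
  qed
  have N0: "0 \<le> N" by (simp add: N_def)
  \<comment> \<open>For \<mu> = L the inequality \<open>*\<close> is linear in t and forces N = 0.
    Otherwise t = 1 / (L - \<mu>) maximizes its left side.\<close>
  show ?thesis
  proof (cases "\<mu> = L")
    case True
    have "N = 0"
    proof (rule ccontr)
      assume "N \<noteq> 0"
      hence "0 < N" using N0 by simp
      \<comment> \<open>This t makes the left side equal to I + 1.\<close>
      moreover have "2 * ((I + 1) / (2 * N)) * N \<le> I" using *[of "(I + 1) / (2 * N)"] True by simp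
      ultimately show False by (simp add: field_simps)
    qed
    thus ?thesis using True by (simp add: N_def)
  next
    case False
    define s where "s = L - \<mu>"
    have pos: "0 < s" using False assms by (simp add: s_def)
    have "2 * (1 / s) * N - s * (1 / s)\<^sup>2 * N = N / s"
      using pos by (simp add: field_simps power2_eq_square)
    hence "N / s \<le> I" using *[of "1 / s"] unfolding s_def[symmetric] by simp
    hence "N \<le> s * I" using pos by (simp add: divide_le_eq mult.commute)
    thus ?thesis by (simp add: N_def I_def s_def)
  qed
qed

text \<open>The step is (1 - \<alpha> \<mu>) times the identity minus \<alpha> H. After expanding
  the square, cocoercivity of H bounds the term \<alpha>^2 |g|^2, and the cross term absorbs it
  because \<alpha> (L + \<mu>) \<le> 2. Monotonicity of H, that is \<open>0 \<le> I\<close>, comes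
  from adding two strong convexity inequalities.\<close>

lemma gradient_step_contraction:
  fixes F :: "'a::real_inner \<Rightarrow> real"
  assumes upper: "\<And>z z'. F z' \<le> F z + inner (G z) (z' - z) + L / 2 * (norm (z' - z))\<^sup>2"
    and lower: "\<And>z z'. F z' \<ge> F z + inner (G z) (z' - z) + \<mu> / 2 * (norm (z' - z))\<^sup>2"
    and \<mu>: "\<mu> \<le> L" and \<alpha>: "0 \<le> \<alpha>" "\<alpha> * (L + \<mu>) \<le> 2" "\<alpha> * \<mu> \<le> 1"
  shows "norm ((x - \<alpha> *\<^sub>R G x) - (y - \<alpha> *\<^sub>R G y)) \<le> (1 - \<alpha> * \<mu>) * norm (x - y)"
proof -
  define H where "H z = G z - \<mu> *\<^sub>R z" for z
  define g where "g = H x - H y"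
  define I where "I = inner g (x - y)"
  have coco: "(norm g)\<^sup>2 \<le> (L - \<mu>) * I"
    unfolding g_def H_def I_def by (rule strongly_convex_smooth_cocoercive[OF upper lower \<mu>])
  have I: "0 \<le> I"
  proof -
    have "F y + inner (G y) (x - y) + \<mu> / 2 * (norm (x - y))\<^sup>2 \<le> F x"
      "F x + inner (G x) (y - x) + \<mu> / 2 * (norm (x - y))\<^sup>2 \<le> F y"
      using lower[of y x] lower[of x y] by (simp_all add: norm_minus_commute)
    thus ?thesis
      unfolding I_def g_def H_def power2_norm_eq_inner
      by (simp add: inner_diff_left inner_diff_right inner_commute algebra_simps)
  qed
  have step: "(x - \<alpha> *\<^sub>R G x) - (y - \<alpha> *\<^sub>R G y) = (1 - \<alpha> * \<mu>) *\<^sub>R (x - y) - \<alpha> *\<^sub>R g"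
    by (simp add: g_def H_def algebra_simps)
  have "(norm (a *\<^sub>R d - \<alpha> *\<^sub>R g))\<^sup>2
      = a\<^sup>2 * (norm d)\<^sup>2 - 2 * \<alpha> * a * inner g d + \<alpha>\<^sup>2 * (norm g)\<^sup>2" for a and d :: 'a
    unfolding power2_norm_eq_inner
    by (simp add: inner_diff_left inner_diff_right inner_commute power2_eq_square algebra_simps)
  hence "(norm ((x - \<alpha> *\<^sub>R G x) - (y - \<alpha> *\<^sub>R G y)))\<^sup>2
      = (1 - \<alpha> * \<mu>)\<^sup>2 * (norm (x - y))\<^sup>2 - 2 * \<alpha> * (1 - \<alpha> * \<mu>) * I + \<alpha>\<^sup>2 * (norm g)\<^sup>2"
    unfolding step I_def .
  also have "\<dots> \<le> (1 - \<alpha> * \<mu>)\<^sup>2 * (norm (x - y))\<^sup>2"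
  proof -
    have "\<alpha>\<^sup>2 * (norm g)\<^sup>2 \<le> \<alpha>\<^sup>2 * ((L - \<mu>) * I)" using coco by (intro mult_left_mono) auto
    also have "\<dots> = (\<alpha> * I) * (\<alpha> * (L - \<mu>))" by (simp add: power2_eq_square)
    also have "\<dots> \<le> (\<alpha> * I) * (2 * (1 - \<alpha> * \<mu>))"
      using \<alpha> I by (intro mult_left_mono) (auto simp: algebra_simps)
    finally show ?thesis by (simp add: algebra_simps)
  qed
  also have "\<dots> = ((1 - \<alpha> * \<mu>) * norm (x - y))\<^sup>2" by (simp add: power_mult_distrib)
  finally show ?thesis using \<alpha> by (intro power2_le_imp_le[of "norm _"]) auto
qed

section \<open>Existence and stationarity of the minimizer\<close>

text \<open>\<open>minimizer\<close> is a choice, so a minimum has to exist first. Outside the ball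
  of radius 2 |g| / \<mu> the quadratic term dominates the linear one and F is at least F 0; inside,
  compactness gives a minimum.\<close>

lemma minimizer_is_minimum:
  fixes F :: "'a::euclidean_space \<Rightarrow> real"
  assumes cont: "continuous_on UNIV F" and \<mu>: "0 < \<mu>"
    and lower: "\<And>z. F z \<ge> F 0 + inner g z + \<mu> / 2 * (norm z)\<^sup>2"
  shows "F (minimizer F) \<le> F z"
proof -
  define R where "R = 2 * norm g / \<mu>"
  have R: "0 \<le> R" using \<mu> by (simp add: R_def)
  obtain m where m: "m \<in> cball 0 R" "\<And>y. y \<in> cball 0 R \<Longrightarrow> F m \<le> F y"
    using continuous_attains_inf[of "cball 0 R" F] cont R
    by (metis all_not_in_conv centre_in_cball compact_cball continuous_on_subset subset_UNIV)
  have "F m \<le> F z" for z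
  proof (cases "norm z \<le> R")
    case False
    have "\<mu> / 2 * (norm z)\<^sup>2 = norm z * (\<mu> / 2 * norm z)" by (simp add: power2_eq_square)
    also have "\<dots> \<ge> norm z * norm g"
      using False \<mu> by (intro mult_left_mono) (auto simp: R_def field_simps)
    finally have "0 \<le> inner g z + \<mu> / 2 * (norm z)\<^sup>2"
      using Cauchy_Schwarz_ineq2[of g z] by (simp add: mult.commute)
    thus ?thesis using lower[of z] m(2)[of 0] R by simp
  qed (use m in auto)
  hence "is_arg_min F (\<lambda>_. True) m" by (simp add: is_arg_min_linorder)
  hence "is_arg_min F (\<lambda>_. True) (minimizer F)"
    unfolding minimizer_def arg_min_def by (rule someI)
  thus ?thesis by (simp add: is_arg_min_linorder)
qed

lemma GDERIV_at_minimum: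
  assumes F: "GDERIV F m :> D" and min: "\<And>z. F m \<le> F z"
  shows "D = 0"
proof -
  have "(\<lambda>h. inner h D) = (\<lambda>h. 0)"
    by (rule differential_zero_maxmin[of m UNIV F]) (use F min in \<open>auto simp: gderiv_def\<close>)
  thus ?thesis by (metis inner_eq_zero_iff)
qed

lemma GDERIV_global_obj:
  fixes f :: "'n::finite \<Rightarrow> 'a::euclidean_space \<Rightarrow> real"
  assumes "\<And>i z. f i differentiable (at z)"
  shows "GDERIV (global_obj f) z :> (1 / real CARD('n)) *\<^sub>R (\<Sum>i\<in>UNIV. grad (f i) z)"
proof -
  have "((\<lambda>z. f i z) has_derivative (\<lambda>h. inner h (grad (f i) z))) (at z)" for i
    using GDERIV_grad[OF assms] unfolding gderiv_def .
  hence "((\<lambda>z. (1 / real CARD('n)) * (\<Sum>i\<in>UNIV. f i z)) has_derivative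
      (\<lambda>h. (1 / real CARD('n)) * (\<Sum>i\<in>UNIV. inner h (grad (f i) z)))) (at z)"
    by (intro has_derivative_mult_right has_derivative_sum)
  thus ?thesis unfolding gderiv_def global_obj_def[abs_def] by (simp add: inner_sum_right)
qed

section \<open>Averaging over the network\<close>

lemmas cart_eq_iff = Finite_Cartesian_Product.vec_eq_iff

text \<open>The view complementary to \<open>block\<close>: a fixed coordinate across all nodes. The
  Kronecker product of V with the identity acts on every slice as V, so estimates on R^n lift slice
  by slice.\<close>

definition slice :: "real^('n::finite \<times> 'd::finite) \<Rightarrow> 'd \<Rightarrow> real^'n" where
  "slice x a = (\<chi> i. x $ (i, a))"

lemma slice_nth [simp]: "slice x a $ i = x $ (i, a)"
  by (simp add: slice_def)

lemma slice_eqI: "(\<And>a. slice x a = slice y a) \<Longrightarrow> x = y"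
  by (metis slice_nth surj_pair cart_eq_iff)

lemma slice_diff: "slice (x - y) a = slice x a - slice y a"
  by (simp add: cart_eq_iff)

lemma norm_sq_vec: "(norm (u :: real^'n))\<^sup>2 = (\<Sum>i\<in>UNIV. (u $ i)\<^sup>2)"
  by (simp add: norm_vec_def L2_set_def sum_nonneg)

lemma norm_sq_slice:
  fixes x :: "real^('n::finite \<times> 'd::finite)"
  shows "(norm x)\<^sup>2 = (\<Sum>a\<in>UNIV. (norm (slice x a))\<^sup>2)"
proof -
  have "(norm x)\<^sup>2 = (\<Sum>i\<in>UNIV. \<Sum>a\<in>UNIV. (x $ (i, a))\<^sup>2)"
    unfolding norm_sq_vec sum.cartesian_product by (simp add: case_prod_unfold)
  also have "\<dots> = (\<Sum>a\<in>UNIV. \<Sum>i\<in>UNIV. (x $ (i, a))\<^sup>2)" by (rule sum.swap)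
  finally show ?thesis by (simp add: norm_sq_vec)
qed

lemma norm_sq_block:
  fixes x :: "real^('n::finite \<times> 'd::finite)"
  shows "(norm x)\<^sup>2 = (\<Sum>i\<in>UNIV. (norm (block x i))\<^sup>2)"
proof -
  have "(norm x)\<^sup>2 = (\<Sum>i\<in>UNIV. \<Sum>a\<in>UNIV. (x $ (i, a))\<^sup>2)"
    unfolding norm_sq_vec sum.cartesian_product by (simp add: case_prod_unfold)
  thus ?thesis by (simp add: norm_sq_vec block_def)
qed

lemma norm_le_slicewise:
  fixes x y :: "real^('n::finite \<times> 'd::finite)"
  assumes "0 \<le> c" and le: "\<And>a. norm (slice y a) \<le> c * norm (slice x a)"
  shows "norm y \<le> c * norm x"
proof (rule power2_le_imp_le)
  have "(norm y)\<^sup>2 \<le> (\<Sum>a\<in>UNIV. (c * norm (slice x a))\<^sup>2)"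
    unfolding norm_sq_slice[of y] using le by (intro sum_mono power_mono) auto
  thus "(norm y)\<^sup>2 \<le> (c * norm x)\<^sup>2"
    by (simp add: power_mult_distrib norm_sq_slice[of x] sum_distrib_left)
qed (use assms in auto)

lemma norm_le_blockwise:
  fixes x y :: "real^('n::finite \<times> 'd::finite)"
  assumes "0 \<le> c" and le: "\<And>i. norm (block y i) \<le> c * norm (block x i)"
  shows "norm y \<le> c * norm x"
proof (rule power2_le_imp_le)
  have "(norm y)\<^sup>2 \<le> (\<Sum>i\<in>UNIV. (c * norm (block x i))\<^sup>2)"
    unfolding norm_sq_block[of y] using le by (intro sum_mono power_mono) auto
  thus "(norm y)\<^sup>2 \<le> (c * norm x)\<^sup>2"
    by (simp add: power_mult_distrib norm_sq_block[of x] sum_distrib_left)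
qed (use assms in auto)

text \<open>Cauchy-Schwarz against the all-ones vector.\<close>

lemma sum_norm_block_le:
  fixes x :: "real^('n::finite \<times> 'd::finite)"
  shows "(\<Sum>i\<in>UNIV. norm (block x i)) \<le> sqrt (real CARD('n)) * norm x"
proof -
  have "norm x = L2_set (\<lambda>i. norm (block x i)) UNIV"
    using norm_sq_block[of x] by (simp add: L2_set_def real_sqrt_unique)
  moreover have "L2_set (\<lambda>i::'n. 1) UNIV = sqrt (real CARD('n))" by (simp add: L2_set_def)
  ultimately show ?thesis
    using L2_set_mult_ineq[of "\<lambda>i::'n. 1" "\<lambda>i. norm (block x i)" UNIV] by simp
qed

lemma block_stack [simp]: "block (stack v) i = v i"
  by (simp add: block_def stack_def cart_eq_iff)

lemma block_diff: "block (x - y) i = block x i - block y i"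
  by (simp add: block_def cart_eq_iff)

lemma block_add: "block (x + y) i = block x i + block y i"
  by (simp add: block_def cart_eq_iff)

lemma block_scaleR: "block (c *\<^sub>R x) i = c *\<^sub>R block x i"
  by (simp add: block_def cart_eq_iff)

lemma block_mean_diff: "block_mean (x - y) = block_mean x - block_mean y"
  by (simp add: block_mean_def block_diff sum_subtractf scaleR_diff_right)

lemma block_mean_add: "block_mean (x + y) = block_mean x + block_mean y"
  by (simp add: block_mean_def block_add sum.distrib scaleR_add_right)

lemma block_mean_scaleR: "block_mean (c *\<^sub>R x) = c *\<^sub>R block_mean x"
  by (simp add: block_mean_def block_scaleR scaleR_sum_right[symmetric])

lemma stacked_mean_diff: "stacked_mean (x - y) = stacked_mean x - stacked_mean y"
  by (simp add: stacked_mean_def block_mean_diff stack_def cart_eq_iff)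

lemma stacked_mean_add: "stacked_mean (x + y) = stacked_mean x + stacked_mean y"
  by (simp add: stacked_mean_def block_mean_add stack_def cart_eq_iff)

lemma stacked_mean_scaleR: "stacked_mean (c *\<^sub>R x) = c *\<^sub>R stacked_mean x"
  by (simp add: stacked_mean_def block_mean_scaleR stack_def cart_eq_iff)

lemma norm_stacked_mean:
  fixes x :: "real^('n::finite \<times> 'd::finite)"
  shows "norm (stacked_mean x) = sqrt (real CARD('n)) * norm (block_mean x)"
proof -
  have "(norm (stacked_mean x))\<^sup>2 = (sqrt (real CARD('n)) * norm (block_mean x))\<^sup>2"
    unfolding norm_sq_block[of "stacked_mean x"] by (simp add: stacked_mean_def power_mult_distrib)
  thus ?thesis by (simp add: power2_eq_iff_nonneg)
qed

lemma slice_stacked_mean: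
  "slice (stacked_mean (x :: real^('n::finite \<times> 'd::finite))) a
    = (\<chi> i. (\<Sum>j\<in>UNIV. slice x a $ j) / real CARD('n))"
  by (simp add: cart_eq_iff stacked_mean_def stack_def block_mean_def block_def)

text \<open>Removing the mean c is an orthogonal projection: it lowers the squared norm by n
  c^2.\<close>

lemma norm_diff_mean_le:
  fixes u :: "real^'n"
  shows "norm (u - (\<chi> i. (\<Sum>j\<in>UNIV. u $ j) / real CARD('n))) \<le> norm u"
proof (rule power2_le_imp_le)
  define c where "c = (\<Sum>j\<in>UNIV. u $ j) / real CARD('n)"
  have "(norm (u - (\<chi> i. c)))\<^sup>2 = (\<Sum>i\<in>UNIV. (u $ i)\<^sup>2 - 2 * c * u $ i + c\<^sup>2)"
    unfolding norm_sq_vec by (simp add: power2_diff algebra_simps)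
  also have "\<dots> = (norm u)\<^sup>2 - 2 * c * (\<Sum>i\<in>UNIV. u $ i) + real CARD('n) * c\<^sup>2"
    by (simp only: sum.distrib sum_subtractf sum_distrib_left[symmetric] norm_sq_vec sum_constant)
  also have "(\<Sum>i\<in>UNIV. u $ i) = real CARD('n) * c" by (simp add: c_def)
  finally have "(norm (u - (\<chi> i. c)))\<^sup>2 = (norm u)\<^sup>2 - real CARD('n) * c\<^sup>2"
    by (simp add: power2_eq_square)
  thus "(norm (u - (\<chi> i. (\<Sum>j\<in>UNIV. u $ j) / real CARD('n))))\<^sup>2 \<le> (norm u)\<^sup>2"
    unfolding c_def[symmetric] by simp
qed simp

lemma norm_diff_stacked_mean_le: "norm (x - stacked_mean x) \<le> norm x"
  using norm_le_slicewise[of 1 "x - stacked_mean x" x]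
  by (simp add: slice_diff slice_stacked_mean norm_diff_mean_le del: slice_nth)

section \<open>Doubly stochastic mixing and its powers\<close>

text \<open>Each row of V is a probability vector, so nonnegativity of the variance bounds the
  square of an averaged entry by the average of squares. Summing over rows, the column sums return
  the squared norm of u.\<close>

lemma matrix_vector_nonexpansive:
  fixes V :: "real^'n^'n"
  assumes "doubly_stochastic V"
  shows "norm (V *v u) \<le> norm u"
proof (rule power2_le_imp_le)
  have V: "\<And>i j. 0 \<le> V $ i $ j" "\<And>i. (\<Sum>j\<in>UNIV. V $ i $ j) = 1" "\<And>j. (\<Sum>i\<in>UNIV. V $ i $ j) = 1"
    using assms by (auto simp: doubly_stochastic_def)
  have "((V *v u) $ i)\<^sup>2 \<le> (\<Sum>j\<in>UNIV. V $ i $ j * (u $ j)\<^sup>2)" for i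
  proof -
    define m where "m = (V *v u) $ i"
    have m: "m = (\<Sum>j\<in>UNIV. V $ i $ j * u $ j)" by (simp add: m_def matrix_vector_mult_def)
    have "0 \<le> (\<Sum>j\<in>UNIV. V $ i $ j * (u $ j - m)\<^sup>2)" using V by (intro sum_nonneg) auto
    also have "\<dots> = (\<Sum>j\<in>UNIV. V $ i $ j * (u $ j)\<^sup>2 - 2 * m * (V $ i $ j * u $ j) + m\<^sup>2 * V $ i $ j)"
      by (intro sum.cong) (simp_all add: power2_diff algebra_simps)
    also have "\<dots> = (\<Sum>j\<in>UNIV. V $ i $ j * (u $ j)\<^sup>2) - 2 * m * m + m\<^sup>2"
      by (simp add: sum.distrib sum_subtractf sum_distrib_left[symmetric] V m[symmetric])
    finally show ?thesis by (simp add: m_def power2_eq_square)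
  qed
  hence "(norm (V *v u))\<^sup>2 \<le> (\<Sum>i\<in>UNIV. \<Sum>j\<in>UNIV. V $ i $ j * (u $ j)\<^sup>2)"
    unfolding norm_sq_vec by (intro sum_mono)
  also have "\<dots> = (\<Sum>j\<in>UNIV. (\<Sum>i\<in>UNIV. V $ i $ j) * (u $ j)\<^sup>2)"
    unfolding sum_distrib_right by (rule sum.swap)
  finally show "(norm (V *v u))\<^sup>2 \<le> (norm u)\<^sup>2" by (simp add: V norm_sq_vec)
qed simp

lemma sum_matrix_vector:
  fixes V :: "real^'n^'n"
  assumes "doubly_stochastic V"
  shows "(\<Sum>i\<in>UNIV. (V *v u) $ i) = (\<Sum>i\<in>UNIV. u $ i)"
proof -
  have "(\<Sum>i\<in>UNIV. (V *v u) $ i) = (\<Sum>j\<in>UNIV. (\<Sum>i\<in>UNIV. V $ i $ j) * u $ j)"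
    unfolding matrix_vector_mult_def sum_distrib_right by (simp, rule sum.swap)
  thus ?thesis using assms by (simp add: doubly_stochastic_def)
qed

lemma matrix_vector_const:
  fixes V :: "real^'n^'n"
  assumes "doubly_stochastic V"
  shows "V *v (\<chi> i. c) = (\<chi> i. c)"
  using assms by (simp add: cart_eq_iff matrix_vector_mult_def doubly_stochastic_def
      sum_distrib_right[symmetric])

lemma mixing_factor_nonneg: "0 \<le> mixing_factor V"
  unfolding mixing_factor_def spectral_norm_def by (intro onorm_pos_le matrix_vector_mul_bounded_linear)

lemma norm_le_spectral_norm: "norm (V *v u) \<le> spectral_norm V * norm u" for V :: "real^'n^'m"
  unfolding spectral_norm_def by (intro onorm matrix_vector_mul_bounded_linear)

text \<open>The averaging matrix annihilates zero-sum vectors, so on them V agrees with the matrix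
  whose norm is \<open>mixing_factor V\<close>.\<close>

lemma matrix_vector_mixing:
  fixes V :: "real^'n^'n"
  assumes "(\<Sum>i\<in>UNIV. u $ i) = 0"
  shows "norm (V *v u) \<le> mixing_factor V * norm u"
proof -
  have "(\<chi> i j. 1 / real CARD('n)) *v u = (0 :: real^'n)"
    using assms by (simp add: cart_eq_iff matrix_vector_mult_def sum_divide_distrib[symmetric])
  thus ?thesis using norm_le_spectral_norm[of "V - (\<chi> i j. 1 / real CARD('n))" u]
    by (simp add: mixing_factor_def matrix_vector_mult_diff_rdistrib)
qed

lemma slice_kronecker: "slice (kronecker V (mat 1) *v x) a = V *v slice x a"
proof (subst cart_eq_iff, intro allI)
  fix i
  have "slice (kronecker V (mat 1) *v x) a $ i
      = (\<Sum>j\<in>UNIV. \<Sum>b\<in>UNIV. V $ i $ j * (if a = b then 1 else 0) * x $ (j, b))"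
    unfolding sum.cartesian_product
    by (simp add: matrix_vector_mult_def kronecker_def Finite_Cartesian_Product.mat_def case_prod_unfold)
  also have "\<dots> = (\<Sum>j\<in>UNIV. V $ i $ j * x $ (j, a))"
    by (intro sum.cong refl) (simp add: if_distrib if_distribR cong: if_cong)
  finally show "slice (kronecker V (mat 1) *v x) a $ i = (V *v slice x a) $ i"
    by (simp add: matrix_vector_mult_def)
qed

lemma slice_Z_power: "slice (Z_power V m *v x) a = matrix_power V m *v slice x a"
  unfolding Z_power_def
  by (induction m) (simp_all add: matrix_vector_mul_assoc[symmetric] slice_kronecker del: slice_nth)

lemma matrix_power_vector_nonexpansive:
  assumes "doubly_stochastic V"
  shows "norm (matrix_power V m *v u) \<le> norm u"
  by (induction m)
    (simp_all add: matrix_vector_mul_assoc[symmetric] order_trans[OF matrix_vector_nonexpansive[OF assms]])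

lemma sum_matrix_power_vector:
  assumes "doubly_stochastic V"
  shows "(\<Sum>i\<in>UNIV. (matrix_power V m *v u) $ i) = (\<Sum>i\<in>UNIV. u $ i)"
  by (induction m) (simp_all add: matrix_vector_mul_assoc[symmetric] sum_matrix_vector[OF assms])

lemma matrix_power_vector_const:
  assumes "doubly_stochastic V"
  shows "matrix_power V m *v (\<chi> i. c) = (\<chi> i. c)"
  by (induction m) (simp_all add: matrix_vector_mul_assoc[symmetric] matrix_vector_const[OF assms])

text \<open>V preserves the zero sum, so the one-step contraction can be iterated.\<close>

lemma matrix_power_vector_mixing:
  assumes "doubly_stochastic V" and "(\<Sum>i\<in>UNIV. u $ i) = 0"
  shows "norm (matrix_power V m *v u) \<le> mixing_factor V ^ m * norm u"
proof (induction m)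
  case (Suc m)
  have "norm (matrix_power V (Suc m) *v u) \<le> mixing_factor V * norm (matrix_power V m *v u)"
    by (simp add: matrix_vector_mul_assoc[symmetric] matrix_vector_mixing
        sum_matrix_power_vector[OF assms(1)] assms(2))
  also have "\<dots> \<le> mixing_factor V * (mixing_factor V ^ m * norm u)"
    by (intro mult_left_mono Suc mixing_factor_nonneg)
  finally show ?case by simp
qed simp

lemma norm_Z_power_le:
  assumes "doubly_stochastic V"
  shows "norm (Z_power V m *v x) \<le> norm x"
  using norm_le_slicewise[of 1 "Z_power V m *v x" x]
  by (simp add: slice_Z_power matrix_power_vector_nonexpansive[OF assms] del: slice_nth)

lemma Z_power_stacked_mean:
  assumes "doubly_stochastic V"
  shows "Z_power V m *v stacked_mean x = stacked_mean x"
  by (rule slice_eqI)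
    (simp add: slice_Z_power slice_stacked_mean matrix_power_vector_const[OF assms] del: slice_nth)

lemma stacked_mean_Z_power:
  assumes "doubly_stochastic V"
  shows "stacked_mean (Z_power V m *v x) = stacked_mean x"
  by (rule slice_eqI)
    (simp add: slice_Z_power slice_stacked_mean sum_matrix_power_vector[OF assms] del: slice_nth)

lemma block_mean_eq_block_stacked_mean: "block_mean x = block (stacked_mean x) i"
  by (simp add: stacked_mean_def)

lemma block_mean_Z_power:
  assumes "doubly_stochastic V"
  shows "block_mean (Z_power V m *v x) = block_mean x"
  by (simp add: block_mean_eq_block_stacked_mean[of _ undefined] stacked_mean_Z_power[OF assms])

text \<open>Mixing commutes with removing the mean, and every slice of the deviation from the mean
  has zero sum.\<close>

lemma norm_Z_power_diff_stacked_mean_le: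
  fixes x :: "real^('n::finite \<times> 'd::finite)"
  assumes "doubly_stochastic V"
  shows "norm (Z_power V m *v x - stacked_mean (Z_power V m *v x))
    \<le> mixing_factor V ^ m * norm (x - stacked_mean x)"
proof -
  define u where "u = x - stacked_mean x"
  have u: "Z_power V m *v x - stacked_mean (Z_power V m *v x) = Z_power V m *v u"
    by (simp add: u_def matrix_vector_mult_diff_distrib Z_power_stacked_mean[OF assms]
        stacked_mean_Z_power[OF assms])
  have "(\<Sum>i\<in>UNIV. slice u a $ i) = 0" for a
    unfolding u_def slice_diff slice_stacked_mean by (simp add: sum_subtractf)
  hence "norm (Z_power V m *v u) \<le> mixing_factor V ^ m * norm u"
    by (intro norm_le_slicewise)
      (simp_all add: slice_Z_power matrix_power_vector_mixing[OF assms] mixing_factor_nonneg del: slice_nth)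
  thus ?thesis unfolding u by (simp add: u_def)
qed

text \<open>This bound is the origin of the factor 2 in front of
  \<open>\<eta>2 * p * \<beta>4 ^ nc\<close> in the step-size condition.\<close>

lemma spectral_norm_Z_power_minus_1_le:
  assumes "doubly_stochastic V"
  shows "spectral_norm (Z_power V m - mat 1) \<le> 2"
  unfolding spectral_norm_def
proof (rule onorm_le)
  fix x :: "real^('a \<times> 'b)"
  have "norm ((Z_power V m - mat 1) *v x) \<le> norm (Z_power V m *v x) + norm x"
    by (simp add: matrix_vector_mult_diff_rdistrib norm_triangle_ineq4)
  thus "norm ((Z_power V m - mat 1) *v x) \<le> 2 * norm x"
    using norm_Z_power_le[OF assms, of m x] by simp
qed

section \<open>Independent coin tosses\<close>

context prob_space
begin

text \<open>A function of the first k tosses takes finitely many values and is therefore bounded; it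
  is measurable because a finite product of count spaces is again a count space.\<close>

lemma bernoulli_iid_integrable:
  fixes h :: "(nat \<Rightarrow> bool) \<Rightarrow> real"
  assumes \<theta>: "bernoulli_iid M p \<theta>"
    and h: "\<And>s t. (\<And>j. j < k \<Longrightarrow> s j = t j) \<Longrightarrow> h s = h t"
  shows "integrable M (\<lambda>\<omega>. h (\<lambda>j. \<theta> j \<omega>))"
proof -
  have rv: "random_variable (count_space UNIV) (\<theta> j)" for j
    using \<theta> unfolding bernoulli_iid_def indep_vars_def by simp
  \<comment> \<open>The restriction is \<open>undefined\<close> from index k on, where
    \<open>h\<close> does not look.\<close>
  let ?T = "\<lambda>\<omega>. \<lambda>j\<in>{..<k}. \<theta> j \<omega>"
  have meas: "h \<in> borel_measurable (PiM {..<k} (\<lambda>_. count_space UNIV))"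
    by (simp add: count_space_PiM_finite)
  have eq: "h (\<lambda>j. \<theta> j \<omega>) = h (?T \<omega>)" for \<omega> by (rule h) simp
  have fin: "finite (range (\<lambda>\<omega>. h (?T \<omega>)))"
  proof (rule finite_subset)
    show "range (\<lambda>\<omega>. h (?T \<omega>)) \<subseteq> h ` (PiE {..<k} (\<lambda>_. UNIV))" by auto
  qed (auto intro!: finite_imageI finite_PiE)
  then obtain B where "\<And>\<omega>. norm (h (?T \<omega>)) \<le> B"
    using finite_imp_bounded[OF fin] unfolding bounded_iff by auto
  moreover have "(\<lambda>\<omega>. h (?T \<omega>)) \<in> borel_measurable M"
    by (rule measurable_compose[OF _ meas]) (intro measurable_restrict rv)
  ultimately show ?thesis unfolding eq by (intro integrable_const_bound[of _ B]) auto
qed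

text \<open>\<open>c\<close> sees only toss k and \<open>h\<close> only the tosses before it, so the
  two factors are independent and the expectation splits.\<close>

lemma bernoulli_iid_expectation_mult:
  fixes h :: "(nat \<Rightarrow> bool) \<Rightarrow> real"
  assumes \<theta>: "bernoulli_iid M p \<theta>" and p: "0 \<le> p" "p \<le> 1"
    and h: "\<And>s t. (\<And>j. j < k \<Longrightarrow> s j = t j) \<Longrightarrow> h s = h t"
  shows "expectation (\<lambda>\<omega>. c (\<theta> k \<omega>) * h (\<lambda>j. \<theta> j \<omega>))
    = (p * c True + (1 - p) * c False) * expectation (\<lambda>\<omega>. h (\<lambda>j. \<theta> j \<omega>))"
proof -
  have ind: "indep_vars (\<lambda>_. count_space UNIV) \<theta> UNIV"
    and distr: "distr M (count_space UNIV) (\<theta> k) = measure_pmf (bernoulli_pmf p)"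
    using \<theta> unfolding bernoulli_iid_def by auto
  have rv: "random_variable (count_space UNIV) (\<theta> k)"
    using ind unfolding indep_vars_def by simp
  have "indep_var borel ((\<lambda>g. c (g k)) \<circ> (\<lambda>\<omega>. \<lambda>j\<in>{k}. \<theta> j \<omega>)) borel (h \<circ> (\<lambda>\<omega>. \<lambda>j\<in>{..<k}. \<theta> j \<omega>))"
    by (rule indep_var_compose[OF indep_var_restrict[OF ind]]) (auto simp: count_space_PiM_finite)
  moreover have "h \<circ> (\<lambda>\<omega>. \<lambda>j\<in>{..<k}. \<theta> j \<omega>) = (\<lambda>\<omega>. h (\<lambda>j. \<theta> j \<omega>))"
    by (intro ext) (auto intro!: h)
  moreover have "(\<lambda>g. c (g k)) \<circ> (\<lambda>\<omega>. \<lambda>j\<in>{k}. \<theta> j \<omega>) = (\<lambda>\<omega>. c (\<theta> k \<omega>))"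
    by (simp add: fun_eq_iff)
  ultimately have "indep_var borel (\<lambda>\<omega>. c (\<theta> k \<omega>)) borel (\<lambda>\<omega>. h (\<lambda>j. \<theta> j \<omega>))" by simp
  moreover have "integrable M (\<lambda>\<omega>. h (\<lambda>j. \<theta> j \<omega>))"
    by (rule bernoulli_iid_integrable[OF \<theta> h])
  moreover have "integrable M (\<lambda>\<omega>. c (\<theta> k \<omega>))"
    using bernoulli_iid_integrable[OF \<theta>, of "Suc k" "\<lambda>t. c (t k)"] by simp
  ultimately have "expectation (\<lambda>\<omega>. c (\<theta> k \<omega>) * h (\<lambda>j. \<theta> j \<omega>))
      = expectation (\<lambda>\<omega>. c (\<theta> k \<omega>)) * expectation (\<lambda>\<omega>. h (\<lambda>j. \<theta> j \<omega>))"
    by (intro indep_var_lebesgue_integral)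
  also have "expectation (\<lambda>\<omega>. c (\<theta> k \<omega>)) = integral\<^sup>L (distr M (count_space UNIV) (\<theta> k)) c"
    by (rule integral_distr[symmetric]) (use rv in auto)
  also have "\<dots> = p * c True + (1 - p) * c False"
    unfolding distr using p by simp
  finally show ?thesis .
qed

end

text \<open>Turns a pathwise inequality whose coefficients depend on the current coin into one for
  expectations, with coefficients averaged over the coin.\<close>

lemma (in prob_space) bernoulli_iid_expectation_recursion:
  fixes h :: "nat \<Rightarrow> (nat \<Rightarrow> bool) \<Rightarrow> real"
  assumes \<theta>: "bernoulli_iid M p \<theta>" and p: "0 \<le> p" "p \<le> 1"
    and h: "\<And>l s t. (\<And>j. j < k \<Longrightarrow> s j = t j) \<Longrightarrow> h l s = h l t"
    and h': "\<And>s t. (\<And>j. j < Suc k \<Longrightarrow> s j = t j) \<Longrightarrow> h' s = h' t"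
    and le: "\<And>t. h' t \<le> (\<Sum>l<n. c l (t k) * h l t)"
  shows "expectation (\<lambda>\<omega>. h' (\<lambda>j. \<theta> j \<omega>))
    \<le> (\<Sum>l<n. (p * c l True + (1 - p) * c l False) * expectation (\<lambda>\<omega>. h l (\<lambda>j. \<theta> j \<omega>)))"
proof -
  have int: "integrable M (\<lambda>\<omega>. c l (\<theta> k \<omega>) * h l (\<lambda>j. \<theta> j \<omega>))" for l
  proof (rule bernoulli_iid_integrable[OF \<theta>, of "Suc k" "\<lambda>t. c l (t k) * h l t"])
    fix s t :: "nat \<Rightarrow> bool"
    assume eq: "\<And>j. j < Suc k \<Longrightarrow> s j = t j"
    have "h l s = h l t" by (rule h) (simp add: eq)
    thus "c l (s k) * h l s = c l (t k) * h l t" by (simp add: eq)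
  qed
  have "expectation (\<lambda>\<omega>. h' (\<lambda>j. \<theta> j \<omega>)) \<le> expectation (\<lambda>\<omega>. \<Sum>l<n. c l (\<theta> k \<omega>) * h l (\<lambda>j. \<theta> j \<omega>))"
    by (intro integral_mono bernoulli_iid_integrable[OF \<theta> h'] Bochner_Integration.integrable_sum int le)
  also have "\<dots> = (\<Sum>l<n. expectation (\<lambda>\<omega>. c l (\<theta> k \<omega>) * h l (\<lambda>j. \<theta> j \<omega>)))"
    by (intro Bochner_Integration.integral_sum int)
  also have "\<dots> = (\<Sum>l<n. (p * c l True + (1 - p) * c l False) * expectation (\<lambda>\<omega>. h l (\<lambda>j. \<theta> j \<omega>)))"
    by (intro sum.cong refl bernoulli_iid_expectation_mult[OF \<theta> p] h)
  finally show ?thesis .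
qed

section \<open>Error recursion of the algorithm\<close>

text \<open>Supplies the dependence on finitely many past tosses that the expectation lemmas
  require.\<close>

lemma rgta_cong:
  "(\<And>j. j < k \<Longrightarrow> s j = t j) \<Longrightarrow> rgta f W1 W2 W3 W4 nc \<alpha> x0 s k = rgta f W1 W2 W3 W4 nc \<alpha> x0 t k"
  by (induction k) auto

locale rgta_step_setting =
  fixes f :: "'n::finite \<Rightarrow> real^'d::finite \<Rightarrow> real"
    and W1 W2 W3 W4 :: "real^'n^'n"
    and \<alpha> \<mu> L :: real
  assumes W: "doubly_stochastic W1" "doubly_stochastic W2" "doubly_stochastic W3" "doubly_stochastic W4"
    and differentiable: "\<And>i z. f i differentiable (at z)"
    and lipschitz_grad: "\<And>i. L-lipschitz_on UNIV (grad (f i))"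
    and \<mu>: "0 < \<mu>"
    and strong_convexity: "\<And>z z'. global_obj f z' \<ge>
      global_obj f z + inner (grad (global_obj f) z) (z' - z) + \<mu> / 2 * (norm (z' - z))\<^sup>2"
    and \<alpha>: "0 < \<alpha>" "\<alpha> * L \<le> 1"
begin

abbreviation "G \<equiv> grad (global_obj f)"
abbreviation "xstar \<equiv> minimizer (global_obj f)"

lemma G_eq: "G z = (1 / real CARD('n)) *\<^sub>R (\<Sum>i\<in>UNIV. grad (f i) z)"
  by (rule grad_eqI[OF GDERIV_global_obj[OF differentiable]])

lemma GDERIV_G: "GDERIV (global_obj f) z :> G z"
  unfolding G_eq by (rule GDERIV_global_obj[OF differentiable])

lemma grad_lipschitz: "norm (grad (f i) z - grad (f i) z') \<le> L * norm (z - z')"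
  using lipschitz_onD[OF lipschitz_grad, of z z'] by (simp add: dist_norm)

lemma L_nonneg: "0 \<le> L"
  using lipschitz_grad by (rule lipschitz_on_nonneg)

lemma norm_mean_grad_diff_le:
  "norm ((1 / real CARD('n)) *\<^sub>R (\<Sum>i\<in>UNIV. grad (f i) (u i) - grad (f i) (v i)))
    \<le> L / real CARD('n) * (\<Sum>i\<in>UNIV. norm (u i - v i))"
proof -
  have "norm (\<Sum>i\<in>UNIV. grad (f i) (u i) - grad (f i) (v i)) \<le> (\<Sum>i\<in>UNIV. L * norm (u i - v i))"
    by (intro order_trans[OF norm_sum] sum_mono grad_lipschitz)
  also have "\<dots> = L * (\<Sum>i\<in>UNIV. norm (u i - v i))" by (rule sum_distrib_left[symmetric])
  finally show ?thesis by (simp only: norm_scaleR) (simp add: divide_right_mono)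
qed

lemma G_lipschitz: "norm (G z - G z') \<le> L * norm (z - z')"
  using norm_mean_grad_diff_le[of "\<lambda>_. z" "\<lambda>_. z'"]
  by (simp add: G_eq sum_subtractf scaleR_diff_right)

lemma G_upper:
  "global_obj f z' \<le> global_obj f z + inner (G z) (z' - z) + L / 2 * (norm (z' - z))\<^sup>2"
  by (rule lipschitz_gradient_upper_bound[OF GDERIV_G G_lipschitz])

text \<open>The quadratic lower and upper bounds are compared at a displacement of norm 1, for which
  any unit vector serves.\<close>

lemma mu_le_L: "\<mu> \<le> L"
proof -
  define e :: "real^'d" where "e = axis undefined 1"
  have "norm e = 1" by (simp add: e_def norm_axis_1)
  thus ?thesis using strong_convexity[of 0 e] G_upper[of e 0] by simp
qed

lemma G_xstar: "G xstar = 0"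
proof (rule GDERIV_at_minimum[OF GDERIV_G minimizer_is_minimum[OF _ \<mu>]])
  show "continuous_on UNIV (global_obj f)"
    using GDERIV_G unfolding gderiv_def
    by (meson has_derivative_continuous continuous_at_imp_continuous_on)
  show "global_obj f 0 + inner (G 0) z + \<mu> / 2 * (norm z)\<^sup>2 \<le> global_obj f z" for z
    using strong_convexity[of 0 z] by simp
qed

lemma norm_G_le: "norm (G z) \<le> L * norm (z - xstar)"
  using G_lipschitz[of z xstar] by (simp add: G_xstar)

text \<open>The minimizer is a fixed point of the gradient step, so contraction between two points
  becomes contraction towards it.\<close>

lemma gradient_step: "norm (z - \<alpha> *\<^sub>R G z - xstar) \<le> (1 - \<alpha> * \<mu>) * norm (z - xstar)"
proof -
  have "\<alpha> * \<mu> \<le> \<alpha> * L" using \<alpha> mu_le_L by (intro mult_left_mono) auto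
  hence "\<alpha> * \<mu> \<le> 1" "\<alpha> * (L + \<mu>) \<le> 2" unfolding distrib_left using \<alpha>(2) by linarith+
  thus ?thesis
    using gradient_step_contraction[OF G_upper strong_convexity mu_le_L, of \<alpha> z xstar] \<alpha>
    by (simp add: G_xstar)
qed

lemma stacked_grad_lipschitz: "norm (stacked_grad f x - stacked_grad f y) \<le> L * norm (x - y)"
  by (intro norm_le_blockwise L_nonneg) (simp add: stacked_grad_def block_diff grad_lipschitz)

lemma norm_mean_stacked_grad_diff_le:
  "norm (block_mean (stacked_grad f x) - G (block_mean x))
    \<le> L / sqrt (real CARD('n)) * norm (x - stacked_mean x)"
proof -
  let ?n = "real CARD('n)"
  have "block_mean (stacked_grad f x) = (1 / ?n) *\<^sub>R (\<Sum>i\<in>UNIV. grad (f i) (block x i))"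
    by (simp add: block_mean_def stacked_grad_def)
  hence "norm (block_mean (stacked_grad f x) - G (block_mean x))
      \<le> L / ?n * (\<Sum>i\<in>UNIV. norm (block (x - stacked_mean x) i))"
    using norm_mean_grad_diff_le[of "block x" "\<lambda>_. block_mean x"]
    by (simp add: G_eq sum_subtractf scaleR_diff_right block_diff stacked_mean_def)
  also have "\<dots> \<le> L / ?n * (sqrt ?n * norm (x - stacked_mean x))"
    using L_nonneg by (intro mult_left_mono sum_norm_block_le) auto
  also have "\<dots> = L * (sqrt ?n / ?n) * norm (x - stacked_mean x)" by simp
  also have "sqrt ?n / ?n = 1 / sqrt ?n" by (simp add: real_div_sqrt field_simps)
  finally show ?thesis by simp
qed

section \<open>Pathwise error bounds for one iteration\<close>

text \<open>The error matrix of one iteration with m mixing rounds and no randomness. Averaging the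
  cases m = nc and m = 0 over the coin gives \<open>rgta_matrix\<close>.\<close>

definition step_coeff :: "nat \<Rightarrow> nat \<Rightarrow> nat \<Rightarrow> real" where
  "step_coeff m i j =
    [[1 - \<alpha> * \<mu>, \<alpha> * L / sqrt (real CARD('n)), 0],
     [0, mixing_factor W1 ^ m, \<alpha> * mixing_factor W2 ^ m],
     [sqrt (real CARD('n)) * mixing_factor W4 ^ m * \<alpha> * L\<^sup>2,
      mixing_factor W4 ^ m * L * spectral_norm ((Z_power W1 m :: real^('n \<times> 'd)^('n \<times> 'd)) - mat 1)
        + mixing_factor W4 ^ m * \<alpha> * L\<^sup>2,
      mixing_factor W3 ^ m + mixing_factor W4 ^ m * \<alpha> * L]] ! i ! j"

definition errors :: "(real^('n \<times> 'd)) \<times> (real^('n \<times> 'd)) \<Rightarrow> nat \<Rightarrow> real" where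
  "errors xy i =
    [norm (block_mean (fst xy) - xstar), norm (fst xy - stacked_mean (fst xy)),
     norm (snd xy - stacked_mean (snd xy))] ! i"

lemma rgta_step_eq:
  "rgta_step f W1 W2 W3 W4 nc \<alpha> b (x, y) =
    (let m = (if b then nc else 0);
         x' = Z_power W1 m *v x - \<alpha> *\<^sub>R (Z_power W2 m *v y)
     in (x', Z_power W3 m *v y + Z_power W4 m *v (stacked_grad f x' - stacked_grad f x)))"
  by (simp add: rgta_step_def Z_power_def Let_def add_diff_eq)

context
  fixes m :: nat and x y x' y' :: "real^('n \<times> 'd)"
  assumes tracking: "block_mean y = block_mean (stacked_grad f x)"
    and x': "x' = Z_power W1 m *v x - \<alpha> *\<^sub>R (Z_power W2 m *v y)"
    and y': "y' = Z_power W3 m *v y + Z_power W4 m *v (stacked_grad f x' - stacked_grad f x)"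
begin

text \<open>Double stochasticity preserves block means, so the mean tracker changes exactly by the
  change of the mean gradient.\<close>

lemma step_tracking: "block_mean y' = block_mean (stacked_grad f x')"
  by (simp add: y' block_mean_add block_mean_Z_power W block_mean_diff tracking)

text \<open>The new mean is an exact gradient step from the old mean, plus \<alpha> times the error
  of evaluating the local gradients away from the mean.\<close>

lemma step_mean_error:
  "norm (block_mean x' - xstar)
    \<le> (1 - \<alpha> * \<mu>) * norm (block_mean x - xstar)
      + \<alpha> * L / sqrt (real CARD('n)) * norm (x - stacked_mean x)"
proof -
  have "block_mean x' - xstar = (block_mean x - \<alpha> *\<^sub>R G (block_mean x) - xstar)
      - \<alpha> *\<^sub>R (block_mean (stacked_grad f x) - G (block_mean x))"
    by (simp add: x' block_mean_diff block_mean_scaleR block_mean_Z_power W tracking scaleR_diff_right)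
  hence "norm (block_mean x' - xstar) \<le> norm (block_mean x - \<alpha> *\<^sub>R G (block_mean x) - xstar)
      + \<alpha> * norm (block_mean (stacked_grad f x) - G (block_mean x))"
    using \<alpha> by (metis norm_triangle_ineq4 norm_scaleR abs_of_pos)
  also have "\<dots> \<le> (1 - \<alpha> * \<mu>) * norm (block_mean x - xstar)
      + \<alpha> * (L / sqrt (real CARD('n)) * norm (x - stacked_mean x))"
    using \<alpha> by (intro add_mono gradient_step mult_left_mono norm_mean_stacked_grad_diff_le) auto
  finally show ?thesis by simp
qed

lemma step_consensus_error:
  "norm (x' - stacked_mean x')
    \<le> mixing_factor W1 ^ m * norm (x - stacked_mean x)
      + \<alpha> * mixing_factor W2 ^ m * norm (y - stacked_mean y)"
proof -
  let ?a = "Z_power W1 m *v x" and ?b = "Z_power W2 m *v y"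
  have "x' - stacked_mean x' = (?a - stacked_mean ?a) - \<alpha> *\<^sub>R (?b - stacked_mean ?b)"
    by (simp add: x' stacked_mean_diff stacked_mean_scaleR scaleR_diff_right)
  hence "norm (x' - stacked_mean x') \<le> norm (?a - stacked_mean ?a) + \<alpha> * norm (?b - stacked_mean ?b)"
    using \<alpha> by (metis norm_triangle_ineq4 norm_scaleR abs_of_pos)
  also have "\<dots> \<le> mixing_factor W1 ^ m * norm (x - stacked_mean x)
      + \<alpha> * (mixing_factor W2 ^ m * norm (y - stacked_mean y))"
    using \<alpha> by (intro add_mono mult_left_mono norm_Z_power_diff_stacked_mean_le W) auto
  finally show ?thesis by simp
qed

text \<open>y is split into its stacked mean and its deviation. By tracking, the mean is close to
  the gradient of the objective at the mean iterate, which is at most L times the distance to the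
  minimizer; stacking n copies contributes the factor sqrt n.\<close>

lemma norm_tracker_le:
  "norm y \<le> sqrt (real CARD('n)) * L * norm (block_mean x - xstar) + L * norm (x - stacked_mean x)
    + norm (y - stacked_mean y)"
proof -
  let ?n = "real CARD('n)"
  have "norm (block_mean y) \<le> norm (G (block_mean x)) + norm (block_mean y - G (block_mean x))"
    using norm_triangle_sub by blast
  also have "\<dots> \<le> L * norm (block_mean x - xstar) + L / sqrt ?n * norm (x - stacked_mean x)"
    unfolding tracking by (intro add_mono norm_G_le norm_mean_stacked_grad_diff_le)
  finally have "sqrt ?n * norm (block_mean y)
      \<le> sqrt ?n * (L * norm (block_mean x - xstar) + L / sqrt ?n * norm (x - stacked_mean x))"
    by (intro mult_left_mono) auto
  also have "\<dots> = sqrt ?n * L * norm (block_mean x - xstar) + L * norm (x - stacked_mean x)"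
    by (simp add: distrib_left)
  finally have "norm (stacked_mean y)
      \<le> sqrt ?n * L * norm (block_mean x - xstar) + L * norm (x - stacked_mean x)"
    unfolding norm_stacked_mean .
  thus ?thesis using norm_triangle_sub[of y "stacked_mean y"] by simp
qed

text \<open>\<open>Z_power W1 m - mat 1\<close> annihilates stacked means, so it acts on the
  consensus error alone.\<close>

lemma norm_step_le:
  "norm (x' - x)
    \<le> spectral_norm ((Z_power W1 m :: real^('n \<times> 'd)^('n \<times> 'd)) - mat 1) * norm (x - stacked_mean x)
      + \<alpha> * norm y"
proof -
  have "x' - x = (Z_power W1 m - mat 1) *v (x - stacked_mean x) - \<alpha> *\<^sub>R (Z_power W2 m *v y)"
    by (simp add: x' matrix_vector_mult_diff_distrib matrix_vector_mult_diff_rdistrib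
        Z_power_stacked_mean W)
  hence "norm (x' - x) \<le> norm ((Z_power W1 m - mat 1) *v (x - stacked_mean x))
      + \<alpha> * norm (Z_power W2 m *v y)"
    using \<alpha> by (metis norm_triangle_ineq4 norm_scaleR abs_of_pos)
  also have "\<dots> \<le> spectral_norm ((Z_power W1 m :: real^('n \<times> 'd)^('n \<times> 'd)) - mat 1)
      * norm (x - stacked_mean x) + \<alpha> * norm y"
    using \<alpha> by (intro add_mono mult_left_mono norm_le_spectral_norm norm_Z_power_le W) auto
  finally show ?thesis .
qed

text \<open>Removing the mean from the gradient increment does not increase its norm, which is at
  most L |x' - x|; the bounds on the displacement and on the tracker are then inserted.\<close>

lemma step_tracking_error:
  "norm (y' - stacked_mean y') \<le> mixing_factor W3 ^ m * norm (y - stacked_mean y)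
    + mixing_factor W4 ^ m * L
      * (spectral_norm ((Z_power W1 m :: real^('n \<times> 'd)^('n \<times> 'd)) - mat 1) * norm (x - stacked_mean x)
        + \<alpha> * (sqrt (real CARD('n)) * L * norm (block_mean x - xstar) + L * norm (x - stacked_mean x)
            + norm (y - stacked_mean y)))"
    (is "_ \<le> _ + _ * L * ?r")
proof -
  define g where "g = stacked_grad f x' - stacked_grad f x"
  let ?a = "Z_power W3 m *v y" and ?b = "Z_power W4 m *v g"
  have "norm (x' - x) \<le> ?r"
    using \<alpha> by (intro order_trans[OF norm_step_le] add_left_mono mult_left_mono norm_tracker_le) auto
  hence "norm g \<le> L * ?r"
    unfolding g_def by (intro order_trans[OF stacked_grad_lipschitz] mult_left_mono L_nonneg)
  hence g: "norm (g - stacked_mean g) \<le> L * ?r" by (rule order_trans[OF norm_diff_stacked_mean_le])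
  have "y' - stacked_mean y' = (?a - stacked_mean ?a) + (?b - stacked_mean ?b)"
    by (simp add: y' g_def stacked_mean_add)
  hence "norm (y' - stacked_mean y') \<le> norm (?a - stacked_mean ?a) + norm (?b - stacked_mean ?b)"
    by (metis norm_triangle_ineq)
  also have "\<dots> \<le> mixing_factor W3 ^ m * norm (y - stacked_mean y)
      + mixing_factor W4 ^ m * norm (g - stacked_mean g)"
    by (intro add_mono norm_Z_power_diff_stacked_mean_le W)
  also have "\<dots> \<le> mixing_factor W3 ^ m * norm (y - stacked_mean y) + mixing_factor W4 ^ m * (L * ?r)"
    by (intro add_left_mono mult_left_mono g zero_le_power mixing_factor_nonneg)
  finally show ?thesis by simp
qed

lemma step_errors:
  assumes "i < 3"
  shows "errors (x', y') i \<le> (\<Sum>j<3. step_coeff m i j * errors (x, y) j)"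
proof -
  consider "i = 0" | "i = 1" | "i = 2" using assms by linarith
  thus ?thesis
  proof cases
    case 1
    thus ?thesis using step_mean_error
      by (simp add: errors_def step_coeff_def numeral_3_eq_3)
  next
    case 2
    thus ?thesis using step_consensus_error
      by (simp add: errors_def step_coeff_def numeral_3_eq_3)
  next
    case 3
    \<comment> \<open>Collects the nested estimate into the third row of
      \<open>step_coeff\<close>.\<close>
    have "c3 * e3 + c4 * L * (z * e2 + \<alpha> * (s * L * e1 + L * e2 + e3))
        = s * c4 * \<alpha> * L\<^sup>2 * e1 + (c4 * L * z + c4 * \<alpha> * L\<^sup>2) * e2 + (c3 + c4 * \<alpha> * L) * e3"
      for c3 c4 e1 e2 e3 z s :: real
      by (simp add: power2_eq_square algebra_simps)
    from step_tracking_error[unfolded this] show ?thesis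
      by (simp add: 3 errors_def step_coeff_def numeral_3_eq_3)
  qed
qed

end

lemma rgta_tracking:
  "block_mean (snd (rgta f W1 W2 W3 W4 nc \<alpha> x0 t k))
    = block_mean (stacked_grad f (fst (rgta f W1 W2 W3 W4 nc \<alpha> x0 t k)))"
proof (induction k)
  case (Suc k)
  obtain x y where xy: "rgta f W1 W2 W3 W4 nc \<alpha> x0 t k = (x, y)" by force
  hence "block_mean y = block_mean (stacked_grad f x)" using Suc by simp
  from step_tracking[OF this refl refl] show ?case
    by (simp only: rgta.simps xy rgta_step_eq Let_def fst_conv snd_conv)
qed simp

lemma rgta_errors:
  assumes "i < 3"
  shows "errors (rgta f W1 W2 W3 W4 nc \<alpha> x0 t (Suc k)) i
    \<le> (\<Sum>j<3. step_coeff (if t k then nc else 0) i j * errors (rgta f W1 W2 W3 W4 nc \<alpha> x0 t k) j)"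
proof -
  obtain x y where xy: "rgta f W1 W2 W3 W4 nc \<alpha> x0 t k = (x, y)" by force
  have "block_mean y = block_mean (stacked_grad f x)"
    using rgta_tracking[of nc x0 t k] by (simp add: xy)
  from step_errors[OF this refl refl assms] show ?thesis
    by (simp only: rgta.simps xy rgta_step_eq Let_def)
qed

text \<open>For m = 0 all powers of mixing factors are 1, which produces the summand 1 - p of
  \<open>eta\<close>, and the spectral norm term vanishes, so that term enters the matrix with
  weight p only.\<close>

lemma rgta_matrix_entry:
  assumes "i < 3" "j < 3"
  shows "rgta_matrix TYPE('d) W1 W2 W3 W4 \<alpha> \<mu> L nc p $$ (i, j)
    = p * step_coeff nc i j + (1 - p) * step_coeff 0 i j"
proof -
  have "spectral_norm ((Z_power W1 0 :: real^('n \<times> 'd)^('n \<times> 'd)) - mat 1) = 0"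
    by (simp add: Z_power_def spectral_norm_def onorm_zero)
  moreover have "i \<in> {0, 1, 2}" "j \<in> {0, 1, 2}" using assms by auto
  ultimately show ?thesis
    by (elim insertE emptyE)
      (simp_all add: rgta_matrix_def Let_def mat_of_rows_list_def step_coeff_def eta_def, simp_all add: algebra_simps diff_divide_distrib)
qed

lemma rgta_error_eq:
  "rgta_error M \<theta> f W1 W2 W3 W4 nc \<alpha> x0 k = vector (map (\<lambda>i.
     \<integral>\<omega>. errors (rgta f W1 W2 W3 W4 nc \<alpha> x0 (\<lambda>j. \<theta> j \<omega>) k) i \<partial>M) [0, 1, 2])"
  by (simp add: rgta_error_def errors_def Let_def)

end

section \<open>From the expected error recursion to linear convergence\<close>

lemma rgta_matrix_carrier: "rgta_matrix TYPE('d::finite) W1 W2 W3 W4 \<alpha> \<mu> L nc p \<in> carrier_mat 3 3"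
proof -
  have "mat_of_rows_list 3 [u, v, w] \<in> carrier_mat 3 3" for u v w :: "real list"
    by (rule carrier_matI) (simp_all add: mat_of_rows_list_def)
  thus ?thesis unfolding rgta_matrix_def Let_def .
qed

theorem theorem4:
  fixes E :: "('n::finite \<times> 'n) set"
    and f :: "'n \<Rightarrow> real^'d::finite \<Rightarrow> real"
    and W1 W2 W3 W4 :: "real^'n^'n"
    and M :: "'w measure" and \<theta> :: "nat \<Rightarrow> 'w \<Rightarrow> bool"
    and \<alpha> \<mu> L \<kappa> p :: real and nc :: nat
    and \<beta>1 \<beta>3 \<beta>4 \<eta>1 \<eta>2 \<eta>3 \<eta>4 :: real
  assumes undirected: "sym E"
    and connected: "\<And>i j. (i, j) \<in> E\<^sup>*"
    and comm: "communication_matrix E W1" "communication_matrix E W2"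
      "communication_matrix E W3" "communication_matrix E W4"
    and differentiable: "\<And>i z. f i differentiable (at z)"
    and lipschitz_grad: "\<And>i. L-lipschitz_on UNIV (grad (f i))"
    and mu_pos: "0 < \<mu>"
    and strong_convexity: "\<And>z z'. global_obj f z' \<ge>
      global_obj f z + inner (grad (global_obj f) z) (z' - z) + \<mu> / 2 * (norm (z' - z))\<^sup>2"
    and kappa: "\<kappa> = L / \<mu>"
    and p: "0 < p" "p < 1"
    and nc: "1 \<le> nc"
    and beta: "\<beta>1 = mixing_factor W1" "\<beta>3 = mixing_factor W3" "\<beta>4 = mixing_factor W4"
    and beta_less: "\<beta>1 < 1" "\<beta>3 < 1"
    and eta: "\<eta>1 = eta p nc W1" "\<eta>2 = eta p nc W2" "\<eta>3 = eta p nc W3" "\<eta>4 = eta p nc W4"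
    and alpha_pos: "0 < \<alpha>"
    and alpha_less: "\<alpha> < Min
      {1 / L,
       (1 - \<eta>3) / (L * \<eta>4),
       (\<eta>4 * (1 - \<eta>1) + 2 * \<eta>2 * p * \<beta>4 ^ nc) / (2 * \<eta>2 * \<eta>4 * \<kappa> * (L + \<mu>)) *
         (sqrt (1 + 4 * (1 - \<eta>1) * (1 - \<eta>3) * \<eta>2 * \<eta>4 * (\<kappa> + 1) /
                    (\<eta>4 * (1 - \<eta>1) + 2 * \<eta>2 * p * \<beta>4 ^ nc)\<^sup>2) - 1)}"
    and prob: "prob_space M"
    and theta: "bernoulli_iid M p \<theta>"
  shows "real_spectral_radius (rgta_matrix TYPE('d) W1 W2 W3 W4 \<alpha> \<mu> L nc p) < 1 \<and>
    (\<forall>\<delta>>0. \<exists>C>0. \<forall>x0 k.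
       norm (rgta_error M \<theta> f W1 W2 W3 W4 nc \<alpha> x0 k)
         \<le> C * (real_spectral_radius (rgta_matrix TYPE('d) W1 W2 W3 W4 \<alpha> \<mu> L nc p) + \<delta>) ^ k *
           norm (rgta_error M \<theta> f W1 W2 W3 W4 nc \<alpha> x0 0))"

proof -
  let ?A = "rgta_matrix TYPE('d) W1 W2 W3 W4 \<alpha> \<mu> L nc p"
  interpret prob_space M by (rule prob)
  have W: "doubly_stochastic W1" "doubly_stochastic W2" "doubly_stochastic W3" "doubly_stochastic W4"
    using comm by (auto simp: communication_matrix_def)
  \<comment> \<open>The product \<open>p * \<beta>4 ^ nc\<close> is bracketed to match the parameter
    \<open>b\<close> of the determinant lemma.\<close>
  have \<alpha>_bounds: "\<alpha> < 1 / L" "\<alpha> < (1 - \<eta>3) / (L * \<eta>4)"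
    and \<alpha>_root: "\<alpha> < (\<eta>4 * (1 - \<eta>1) + 2 * \<eta>2 * (p * \<beta>4 ^ nc)) / (2 * \<eta>2 * \<eta>4 * \<kappa> * (L + \<mu>)) *
         (sqrt (1 + 4 * (1 - \<eta>1) * (1 - \<eta>3) * \<eta>2 * \<eta>4 * (\<kappa> + 1) /
                    (\<eta>4 * (1 - \<eta>1) + 2 * \<eta>2 * (p * \<beta>4 ^ nc))\<^sup>2) - 1)"
    using alpha_less by (simp_all add: mult.assoc)
  have "0 \<le> L" using lipschitz_grad by (rule lipschitz_on_nonneg)
  \<comment> \<open>Division by zero yields 0, so L = 0 would give \<alpha> < 0.\<close>
  moreover have "L \<noteq> 0" using \<alpha>_bounds(1) alpha_pos by auto
  ultimately have L: "0 < L" by simp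
  have \<alpha>L: "\<alpha> * L \<le> 1" using \<alpha>_bounds(1) L by (simp add: field_simps)
  interpret rgta_step_setting f W1 W2 W3 W4 \<alpha> \<mu> L
    by unfold_locales
      (use W differentiable lipschitz_grad mu_pos strong_convexity alpha_pos \<alpha>L in auto)
  have \<eta>_pos: "0 < eta p nc V" for V :: "real^'n^'n"
    unfolding eta_def using p by (intro add_nonneg_pos mult_nonneg_nonneg zero_le_power mixing_factor_nonneg) auto
  have \<eta>_less: "eta p nc V < 1" if "mixing_factor V < 1" for V :: "real^'n^'n"
  proof -
    \<comment> \<open>As nc is at least 1, the power is at most the mixing factor itself.\<close>
    have "mixing_factor V ^ nc < 1"
      using power_decreasing[OF nc mixing_factor_nonneg[of V]] that by simp
    thus ?thesis using p by (simp add: eta_def)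
  qed
  have \<eta>: "0 < \<eta>2" "0 < \<eta>4" "\<eta>1 < 1" "\<eta>3 < 1"
    using \<eta>_pos \<eta>_less beta_less by (auto simp: eta beta)
  have b: "0 \<le> p * \<beta>4 ^ nc" using p mixing_factor_nonneg[of W4] by (simp add: beta)
  define z where "z = spectral_norm ((Z_power W1 nc :: real^('n \<times> 'd)^('n \<times> 'd)) - mat 1)"
  define w where "w = p * \<beta>4 ^ nc * L * z"
  have z: "0 \<le> z" "z \<le> 2"
    unfolding z_def
    by (simp add: spectral_norm_def onorm_pos_le matrix_vector_mul_bounded_linear)
      (rule spectral_norm_Z_power_minus_1_le[OF W(1)])
  have w: "0 \<le> w" "w \<le> p * \<beta>4 ^ nc * L * 2"
    unfolding w_def using b z L by (auto intro!: mult_left_mono mult_nonneg_nonneg)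
  have diag: "\<eta>3 + \<eta>4 * \<alpha> * L < 1" using \<alpha>_bounds(2) L \<eta> by (simp add: field_simps)
  have det: "\<alpha> * L * \<eta>4 * (1 - \<eta>1) + \<alpha> * \<eta>2 * w + \<alpha>\<^sup>2 * L\<^sup>2 * \<eta>2 * \<eta>4 * (\<kappa> + 1)
      < (1 - \<eta>1) * (1 - \<eta>3)"
  \<comment> \<open>Replacing \<open>w\<close> by its upper bound gives the quadratic that the
    step-size condition controls.\<close>
  proof -
    have "\<alpha> * \<eta>2 * w \<le> \<alpha> * \<eta>2 * (p * \<beta>4 ^ nc * L * 2)"
      using w alpha_pos \<eta> by (intro mult_left_mono) auto
    thus ?thesis
      using step_size_determinant_pos[OF L mu_pos alpha_pos \<eta> b kappa \<alpha>_root]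
      by (simp add: algebra_simps)
  qed
  define s where "s = sqrt (real CARD('n))"
  have s: "0 < s" by (simp add: s_def)
  obtain v0 v2 where v: "0 < v0" "0 < v2"
    "(1 - \<alpha> * \<mu>) * v0 + \<alpha> * L / s < v0"
    "\<eta>1 + \<alpha> * \<eta>2 * v2 < 1"
    "s * \<eta>4 * \<alpha> * L\<^sup>2 * v0 + (w + \<eta>4 * \<alpha> * L\<^sup>2) + (\<eta>3 + \<eta>4 * \<alpha> * L) * v2 < v2"
    using rgta_matrix_subinvariant_vector[OF L mu_pos alpha_pos s \<eta>(1-3) diag kappa det] .
  have A: "?A \<in> carrier_mat 3 3" by (rule rgta_matrix_carrier)
  have A_entries: "?A $$ (i, j) =
      [[1 - \<alpha> * \<mu>, \<alpha> * L / s, 0],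
       [0, \<eta>1, \<alpha> * \<eta>2],
       [s * \<eta>4 * \<alpha> * L\<^sup>2, w + \<eta>4 * \<alpha> * L\<^sup>2, \<eta>3 + \<eta>4 * \<alpha> * L]] ! i ! j"
    if "i < 3" "j < 3" for i j
    using that by (simp add: rgta_matrix_def Let_def mat_of_rows_list_def s_def w_def z_def eta beta)
  have less_3: "i < 3 \<longleftrightarrow> i = 0 \<or> i = 1 \<or> i = 2" for i :: nat by auto
  have "\<alpha> * \<mu> \<le> \<alpha> * L" using alpha_pos mu_le_L by simp
  hence "0 \<le> 1 - \<alpha> * \<mu>" using \<alpha>L by simp
  hence nonneg: "0 \<le> ?A $$ (i, j)" if "i < 3" "j < 3" for i j
    using that A_entries[OF that] L alpha_pos s w \<eta> \<eta>_pos[of W1] \<eta>_pos[of W3]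
    unfolding less_3 by (auto simp: eta)
  have rho: "real_spectral_radius ?A < 1"
  proof (rule real_spectral_radius_less_1[OF A _ nonneg])
    show "0 < [v0, 1, v2] ! i" if "i < 3" for i
      using that v unfolding less_3 by auto
    show "(\<Sum>j<3. ?A $$ (i, j) * [v0, 1, v2] ! j) < [v0, 1, v2] ! i" if "i < 3" for i
      using that v unfolding less_3 by (auto simp: A_entries numeral_3_eq_3)
  qed auto
  define r where "r x0 k i = expectation (\<lambda>\<omega>. errors (rgta f W1 W2 W3 W4 nc \<alpha> x0 (\<lambda>j. \<theta> j \<omega>) k) i)"
    for x0 k i
  have r_nonneg: "0 \<le> r x0 k i" if "i < 3" for x0 k i
    using that unfolding r_def less_3 by (intro integral_nonneg_AE) (auto simp: errors_def)
  have step: "r x0 (Suc k) i \<le> (\<Sum>j<3. ?A $$ (i, j) * r x0 k j)" if "i < 3" for x0 k i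
  proof -
    have cong: "errors (rgta f W1 W2 W3 W4 nc \<alpha> x0 s k) l = errors (rgta f W1 W2 W3 W4 nc \<alpha> x0 t k) l"
      if "\<And>j. j < k \<Longrightarrow> s j = t j" for s t k l
      by (rule arg_cong[where f = "\<lambda>xy. errors xy l", OF rgta_cong[OF that]])
    \<comment> \<open>The conditionals on \<open>True\<close> and \<open>False\<close> are the
      coefficient as a function of the coin, evaluated at its two outcomes.\<close>
    have "r x0 (Suc k) i \<le> (\<Sum>j<3. (p * step_coeff (if True then nc else 0) i j
        + (1 - p) * step_coeff (if False then nc else 0) i j) * r x0 k j)"
      unfolding r_def
    proof (rule bernoulli_iid_expectation_recursion[OF theta])
      show "errors (rgta f W1 W2 W3 W4 nc \<alpha> x0 t (Suc k)) i
        \<le> (\<Sum>j<3. step_coeff (if t k then nc else 0) i j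
            * errors (rgta f W1 W2 W3 W4 nc \<alpha> x0 t k) j)" for t
        by (rule rgta_errors[OF that])
    qed (use p in \<open>auto intro: cong simp del: rgta.simps\<close>)
    also have "\<dots> = (\<Sum>j<3. ?A $$ (i, j) * r x0 k j)"
      using that by (intro sum.cong refl) (simp add: rgta_matrix_entry)
    finally show ?thesis .
  qed
  \<comment> \<open>The expected errors are nonnegative, so the Euclidean norm lies between each
    component and their sum.\<close>
  have norm_error: "norm (rgta_error M \<theta> f W1 W2 W3 W4 nc \<alpha> x0 k) \<le> (\<Sum>i<3. r x0 k i)"
    and r_le: "i < 3 \<Longrightarrow> r x0 k i \<le> norm (rgta_error M \<theta> f W1 W2 W3 W4 nc \<alpha> x0 k)" for x0 k i
  proof -
    define R where "R = rgta_error M \<theta> f W1 W2 W3 W4 nc \<alpha> x0 k"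
    have R: "R $ 1 = r x0 k 0" "R $ 2 = r x0 k 1" "R $ 3 = r x0 k 2"
      unfolding R_def rgta_error_eq r_def by simp_all
    show "norm R \<le> (\<Sum>i<3. r x0 k i)"
      using norm_le_l1_cart[of R] r_nonneg[of 0 x0 k] r_nonneg[of 1 x0 k] r_nonneg[of 2 x0 k]
      by (simp add: sum_3 R eval_nat_numeral)
    show "r x0 k i \<le> norm R" if "i < 3"
      using that component_le_norm_cart[of R 1] component_le_norm_cart[of R 2]
        component_le_norm_cart[of R 3] unfolding less_3 R by auto
  qed
  have "\<exists>C>0. \<forall>x0 k. norm (rgta_error M \<theta> f W1 W2 W3 W4 nc \<alpha> x0 k)
      \<le> C * (real_spectral_radius ?A + \<delta>) ^ k * norm (rgta_error M \<theta> f W1 W2 W3 W4 nc \<alpha> x0 0)"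
    if \<delta>: "0 < \<delta>" for \<delta>
  proof -
    define \<gamma> where "\<gamma> = real_spectral_radius ?A + \<delta>"
    obtain C where C: "0 < C" "\<And>k i j. i < 3 \<Longrightarrow> j < 3 \<Longrightarrow> \<bar>(?A ^\<^sub>m k) $$ (i, j)\<bar> \<le> C * \<gamma> ^ k"
      using pow_mat_entries_spectral_radius_bound[OF A _ \<delta>] unfolding \<gamma>_def by auto
    \<comment> \<open>The factor 9 counts the entries of the matrix power, each at most
      \<open>C * \<gamma> ^ k\<close>.\<close>
    have "norm (rgta_error M \<theta> f W1 W2 W3 W4 nc \<alpha> x0 k)
        \<le> (9 * C) * \<gamma> ^ k * norm (rgta_error M \<theta> f W1 W2 W3 W4 nc \<alpha> x0 0)" (is "_ \<le> _ * ?N") for x0 k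
    proof -
      have "norm (rgta_error M \<theta> f W1 W2 W3 W4 nc \<alpha> x0 k) \<le> (\<Sum>i<3. r x0 k i)" by (rule norm_error)
      also have "\<dots> \<le> (\<Sum>i<3. \<Sum>j<3. (?A ^\<^sub>m k) $$ (i, j) * r x0 0 j)"
        by (intro sum_mono nonneg_recursion_pow_mat_bound[where r = "r x0", OF A nonneg step]) auto
      also have "\<dots> \<le> (\<Sum>i<3::nat. \<Sum>j<3::nat. (C * \<gamma> ^ k) * ?N)"
      proof (intro sum_mono mult_mono)
        fix i j :: nat
        assume "i \<in> {..<3}" "j \<in> {..<3}"
        hence ij: "i < 3" "j < 3" by auto
        show "(?A ^\<^sub>m k) $$ (i, j) \<le> C * \<gamma> ^ k" using C(2)[OF ij, of k] by linarith
        show "0 \<le> C * \<gamma> ^ k" using C(2)[OF ij, of k] by linarith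
        show "r x0 0 j \<le> ?N" "0 \<le> r x0 0 j" using ij by (auto intro: r_le r_nonneg)
      qed
      also have "\<dots> = (9 * C) * \<gamma> ^ k * ?N" by simp
      finally show ?thesis .
    qed
    thus ?thesis using C(1) unfolding \<gamma>_def by (intro exI[of _ "9 * C"]) auto
  qed
  thus ?thesis using rho by blast
qed

end
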